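(* Let $X$ be a compact Hausdorff space, let $A$ be a Banach algebra, and let $\sigma : A \to A$ be a continuous algebra homomorphism. Let $\tilde{\sigma} : C(X,A)\to C(X,A)$ be the continuous homomorphism $\tilde{\sigma}(f) := \sigma\circ f$. If $A$ has a $\sigma$-bounded approximate diagonal, then $C(X,A)$ has a $\tilde{\sigma}$-bounded approximate diagonal.
   Context: $C(X,A)$ denotes the Banach algebra of all continuous functions $X\to A$ with pointwise operations and norm $\|f\|_\infty=\sup_{x\in X}\|f(x)\|$. For a Banach algebra $B$, the projective tensor product $B\hat{\otimes}B$ is a Banach $B$-bimodule with actions determined by $a\cdot(b\otimes c)=ab\otimes c$ and $(b\otimes c)\cdot a=b\otimes ca$, and $\pi:B\hat{\otimes}B\to B$ is the bounded linear product map determined by $\pi(a\otimes b)=ab$. For a continuous homomorphism $\theta:B\to B$, a $\theta$-bounded approximate diagonal for $B$ is a bounded net $(u_\alpha)\subset B\hat{\otimes}B$ such that for every $a\in B$, $\theta(a)\cdot u_\alpha-u_\alpha\cdot\theta(a)\to 0$ and $\pi(u_\alpha)\theta(a)\to\theta(a)$ in norm. *)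

theory Defs
  imports "HOL-Analysis.Analysis"
begin

section \<open>Complex Banach spaces and Banach algebras\<close>

class complex_vector = real_vector +
  fixes scaleC :: "complex \<Rightarrow> 'a \<Rightarrow> 'a"  (infixr \<open>*\<^sub>C\<close> 75)
  assumes scaleC_add_right: "c *\<^sub>C (x + y) = c *\<^sub>C x + c *\<^sub>C y"
    and scaleC_add_left: "(c + d) *\<^sub>C x = c *\<^sub>C x + d *\<^sub>C x"
    and scaleC_scaleC: "c *\<^sub>C (d *\<^sub>C x) = (c * d) *\<^sub>C x"
    and scaleR_scaleC: "r *\<^sub>R x = complex_of_real r *\<^sub>C x"

class complex_normed_vector = complex_vector + real_normed_vector +
  assumes norm_scaleC: "norm (c *\<^sub>C x) = cmod c * norm x"

class complex_banach = complex_normed_vector + complete_space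

subclass (in complex_banach) banach ..

class complex_normed_algebra = complex_normed_vector + real_normed_algebra +
  assumes mult_scaleC_left: "(c *\<^sub>C x) * y = c *\<^sub>C (x * y)"
    and mult_scaleC_right: "x * (c *\<^sub>C y) = c *\<^sub>C (x * y)"

text \<open>Neither a unit nor commutativity is required.\<close>

class complex_banach_algebra = complex_normed_algebra + complete_space

subclass (in complex_banach_algebra) complex_banach ..

lemma scaleC_one: "1 *\<^sub>C (x::'a::complex_vector) = x"
  using scaleR_scaleC[of 1 x] by simp

lemma scaleC_zero_left: "0 *\<^sub>C (x::'a::complex_vector) = 0"
  using scaleR_scaleC[of 0 x] by simp

lemma scaleC_zero_right: "c *\<^sub>C (0::'a::complex_vector) = 0"
  using scaleC_add_right[of c 0 0] by simp

lemma scaleC_minus_right: "c *\<^sub>C (- x) = - (c *\<^sub>C (x::'a::complex_vector))"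
  using scaleC_add_right[of c x "-x"]
  by (simp add: scaleC_zero_right eq_neg_iff_add_eq_0 add.commute)

lemma scaleC_minus_one: "(-1) *\<^sub>C x = - (x::'a::complex_vector)"
  using scaleR_scaleC[of "-1" x] by simp

lemma scaleC_diff_right: "c *\<^sub>C (x - y) = c *\<^sub>C x - c *\<^sub>C (y::'a::complex_vector)"
  using scaleC_add_right[of c x "-y"] by (simp add: scaleC_minus_right)

definition bounded_clinear :: "('a::complex_normed_vector \<Rightarrow> 'b::complex_normed_vector) \<Rightarrow> bool"
  where "bounded_clinear T \<longleftrightarrow> bounded_linear T \<and> (\<forall>c x. T (c *\<^sub>C x) = c *\<^sub>C T x)"

definition bounded_cbilinear ::
    "('a::complex_normed_vector \<Rightarrow> 'b::complex_normed_vector \<Rightarrow> 'c::complex_normed_vector) \<Rightarrow> bool"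
  where "bounded_cbilinear \<phi> \<longleftrightarrow> bounded_bilinear \<phi> \<and>
    (\<forall>c x y. \<phi> (c *\<^sub>C x) y = c *\<^sub>C \<phi> x y) \<and> (\<forall>c x y. \<phi> x (c *\<^sub>C y) = c *\<^sub>C \<phi> x y)"

definition algebra_hom :: "('a::complex_normed_algebra \<Rightarrow> 'b::complex_normed_algebra) \<Rightarrow> bool"
  where "algebra_hom \<theta> \<longleftrightarrow> (\<forall>x y. \<theta> (x + y) = \<theta> x + \<theta> y) \<and> (\<forall>c x. \<theta> (c *\<^sub>C x) = c *\<^sub>C \<theta> x) \<and>
    (\<forall>x y. \<theta> (x * y) = \<theta> x * \<theta> y)"


section \<open>The Banach algebra of continuous functions\<close>

text \<open>
  For a compact space the library type of bounded continuous functions with the supremum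
  norm consists of all continuous functions. The distribution provides completeness only
  for metric domains and no product.
\<close>

lemma bcontfun_of_compact:
  fixes f :: "'x::topological_space \<Rightarrow> 'a::metric_space"
  assumes "compact (UNIV :: 'x set)" "continuous_on UNIV f"
  shows "f \<in> bcontfun"
  using assms by (auto simp: bcontfun_def intro: compact_imp_bounded compact_continuous_image)

instance bcontfun :: (topological_space, complete_space) complete_space
proof
  fix f :: "nat \<Rightarrow> ('a, 'b) bcontfun"
  assume "Cauchy f"
  then obtain g where "uniform_limit UNIV f g sequentially"
    using uniformly_convergent_eq_cauchy[of "\<lambda>_. True" f]
    unfolding Cauchy_def uniform_limit_sequentially_iff
    by (metis dist_fun_lt_imp_dist_val_lt)
  from uniform_limit_bcontfunE[OF this sequentially_bot]
  obtain l' where "g = apply_bcontfun l'" "(f \<longlonglongrightarrow> l')" by metis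
  then show "convergent f"
    by (intro convergentI)
qed

setup_lifting type_definition_bcontfun

instantiation bcontfun :: (topological_space, complex_normed_vector) complex_normed_vector
begin

lift_definition scaleC_bcontfun :: "complex \<Rightarrow> ('a \<Rightarrow>\<^sub>C 'b) \<Rightarrow> ('a \<Rightarrow>\<^sub>C 'b)" is "\<lambda>c f x. c *\<^sub>C f x"
proof -
  fix c :: complex and f :: "'a \<Rightarrow> 'b"
  assume f: "f \<in> bcontfun"
  have l: "bounded_linear (\<lambda>x::'b. c *\<^sub>C x)"
    by (rule bounded_linear_intro[of _ "cmod c"])
      (simp_all add: scaleC_add_right norm_scaleC scaleR_scaleC scaleC_scaleC mult.commute)
  have "bounded (range f)" "continuous_on UNIV f"
    using f by (auto simp: bcontfun_def)
  then show "(\<lambda>x. c *\<^sub>C f x) \<in> bcontfun"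
    using bounded_linear_image[OF _ l] bounded_linear.continuous_on[OF l]
    by (fastforce simp: bcontfun_def image_image)
qed

instance
proof
  fix c d :: complex and r :: real and f g :: "'a \<Rightarrow>\<^sub>C 'b"
  show "c *\<^sub>C (f + g) = c *\<^sub>C f + c *\<^sub>C g"
    by (rule bcontfun_eqI) (simp add: scaleC_bcontfun.rep_eq scaleC_add_right)
  show "(c + d) *\<^sub>C f = c *\<^sub>C f + d *\<^sub>C f"
    by (rule bcontfun_eqI) (simp add: scaleC_bcontfun.rep_eq scaleC_add_left)
  show "c *\<^sub>C (d *\<^sub>C f) = (c * d) *\<^sub>C f"
    by (rule bcontfun_eqI) (simp add: scaleC_bcontfun.rep_eq scaleC_scaleC)
  show "r *\<^sub>R f = complex_of_real r *\<^sub>C f"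
    by (rule bcontfun_eqI) (simp add: scaleC_bcontfun.rep_eq scaleR_scaleC)
  have le: "norm (c *\<^sub>C f) \<le> cmod c * norm f" for c and f :: "'a \<Rightarrow>\<^sub>C 'b"
    by (rule norm_bound) (simp add: scaleC_bcontfun.rep_eq norm_scaleC mult_left_mono norm_bounded)
  have one: "1 *\<^sub>C f = f"
    by (rule bcontfun_eqI) (simp add: scaleC_bcontfun.rep_eq scaleC_one)
  have inv: "inverse c *\<^sub>C (c *\<^sub>C f) = f" if "c \<noteq> 0"
    using that by (intro bcontfun_eqI) (simp add: scaleC_bcontfun.rep_eq scaleC_scaleC scaleC_one)
  show "norm (c *\<^sub>C f) = cmod c * norm f"
  proof (cases "c = 0")
    case True
    then show ?thesis using le[of c f] by simp
  next
    case False
    then have "norm f \<le> cmod (inverse c) * norm (c *\<^sub>C f)"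
      using le[of "inverse c" "c *\<^sub>C f"] inv by simp
    then have "cmod c * norm f \<le> norm (c *\<^sub>C f)"
      using False by (simp add: norm_inverse norm_divide field_simps)
    then show ?thesis using le[of c f] by simp
  qed
qed

end

instantiation bcontfun :: (topological_space, complex_normed_algebra) complex_normed_algebra
begin

lift_definition times_bcontfun :: "('a \<Rightarrow>\<^sub>C 'b) \<Rightarrow> ('a \<Rightarrow>\<^sub>C 'b) \<Rightarrow> ('a \<Rightarrow>\<^sub>C 'b)" is "\<lambda>f g x. f x * g x"
proof -
  fix f g :: "'a \<Rightarrow> 'b"
  assume f: "f \<in> bcontfun" and g: "g \<in> bcontfun"
  obtain K L where KL: "\<And>x. norm (f x) \<le> K" "\<And>x. norm (g x) \<le> L"
    using f g by (auto simp: bcontfun_def bounded_iff)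
  have "norm (f x * g x) \<le> K * L" for x
    using KL norm_mult_ineq[of "f x" "g x"]
    by (meson mult_mono norm_ge_zero order_trans)
  then show "(\<lambda>x. f x * g x) \<in> bcontfun"
    using f g by (intro bcontfun_normI) (auto simp: bcontfun_def intro: continuous_on_mult)
qed

instance
proof
  fix c :: complex and r :: real and f g h :: "'a \<Rightarrow>\<^sub>C 'b"
  show "f * g * h = f * (g * h)"
    by (rule bcontfun_eqI) (simp add: times_bcontfun.rep_eq mult.assoc)
  show "(f + g) * h = f * h + g * h" "f * (g + h) = f * g + f * h"
    by (rule bcontfun_eqI, simp add: times_bcontfun.rep_eq algebra_simps)+
  show "r *\<^sub>R f * g = r *\<^sub>R (f * g)" "f * r *\<^sub>R g = r *\<^sub>R (f * g)"
    by (rule bcontfun_eqI, simp add: times_bcontfun.rep_eq)+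
  show "c *\<^sub>C f * g = c *\<^sub>C (f * g)"
    by (rule bcontfun_eqI) (simp add: times_bcontfun.rep_eq scaleC_bcontfun.rep_eq mult_scaleC_left)
  show "f * c *\<^sub>C g = c *\<^sub>C (f * g)"
    by (rule bcontfun_eqI) (simp add: times_bcontfun.rep_eq scaleC_bcontfun.rep_eq mult_scaleC_right)
  show "norm (f * g) \<le> norm f * norm g"
  proof (rule norm_bound)
    fix x
    have "norm (f x * g x) \<le> norm (f x) * norm (g x)"
      by (rule norm_mult_ineq)
    also have "\<dots> \<le> norm f * norm g"
      by (intro mult_mono norm_bounded) auto
    finally show "norm ((f * g) x) \<le> norm f * norm g"
      by (simp add: times_bcontfun.rep_eq)
  qed
qed

end

instance bcontfun :: (topological_space, complex_banach_algebra) complex_banach_algebra ..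

lifting_update bcontfun.lifting
lifting_forget bcontfun.lifting

lemma norm_bcontfun_eq_SUP: "norm f = (SUP x. norm (apply_bcontfun f x))"
  by (simp add: norm_bcontfun_def dist_bcontfun.rep_eq)

definition comp_bcontfun ::
    "('a::metric_space \<Rightarrow> 'b::metric_space) \<Rightarrow> ('x::topological_space \<Rightarrow>\<^sub>C 'a) \<Rightarrow> ('x \<Rightarrow>\<^sub>C 'b)"
  where "comp_bcontfun \<sigma> f = Bcontfun (\<sigma> \<circ> apply_bcontfun f)"

lemma apply_comp_bcontfun:
  fixes f :: "'x::topological_space \<Rightarrow>\<^sub>C 'a::metric_space"
  assumes "compact (UNIV :: 'x set)" "continuous_on UNIV \<sigma>"
  shows "apply_bcontfun (comp_bcontfun \<sigma> f) x = \<sigma> (apply_bcontfun f x)"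
proof -
  have "\<sigma> \<circ> apply_bcontfun f \<in> bcontfun"
    using assms by (intro bcontfun_of_compact continuous_on_compose)
      (auto intro: continuous_on_subset)
  then show ?thesis by (simp add: comp_bcontfun_def Bcontfun_inverse)
qed

lemma algebra_hom_bounded_linear:
  assumes "algebra_hom \<theta>" "continuous_on UNIV \<theta>"
  shows "bounded_linear \<theta>"
proof -
  have lin: "linear \<theta>"
    using assms(1) by (intro linearI) (auto simp: algebra_hom_def scaleR_scaleC)
  have "isCont \<theta> 0"
    using assms(2) by (simp add: continuous_on_eq_continuous_at)
  moreover have "\<theta> 0 = 0" using lin by (rule linear_0)
  ultimately obtain d where d: "d > 0" "\<And>x. norm x < d \<Longrightarrow> norm (\<theta> x) < 1"
    unfolding continuous_at_eps_delta by (metis diff_zero dist_norm zero_less_one)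
  have "norm (\<theta> x) \<le> norm x * (2 / d)" for x
  proof (cases "x = 0")
    case True
    then show ?thesis using \<open>\<theta> 0 = 0\<close> by simp
  next
    case False
    define s where "s = d / (2 * norm x)"
    have "s > 0" using False d by (simp add: s_def)
    have "norm (s *\<^sub>R x) < d" using False d by (simp add: s_def)
    then have "norm (\<theta> (s *\<^sub>R x)) < 1" by (rule d)
    then have "s * norm (\<theta> x) < 1"
      using lin \<open>s > 0\<close> by (simp add: linear_scale)
    then have "norm (\<theta> x) < 1 / s" using \<open>s > 0\<close> by (simp add: field_simps)
    then show ?thesis using False d by (simp add: s_def field_simps)
  qed
  then have "\<exists>K. \<forall>x. norm (\<theta> x) \<le> norm x * K" by blast
  then show ?thesis
    using lin by (simp add: bounded_linear_def bounded_linear_axioms_def)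
qed

lemma algebra_hom_comp_bcontfun:
  fixes \<sigma> :: "'a::complex_normed_algebra \<Rightarrow> 'a"
  assumes "compact (UNIV :: 'x::topological_space set)" "algebra_hom \<sigma>" "continuous_on UNIV \<sigma>"
  shows "algebra_hom (comp_bcontfun \<sigma> :: ('x \<Rightarrow>\<^sub>C 'a) \<Rightarrow> _)"
    and "continuous_on UNIV (comp_bcontfun \<sigma> :: ('x \<Rightarrow>\<^sub>C 'a) \<Rightarrow> _)"
proof -
  note ap = apply_comp_bcontfun[OF assms(1,3)]
  show hom: "algebra_hom (comp_bcontfun \<sigma> :: ('x \<Rightarrow>\<^sub>C 'a) \<Rightarrow> _)"
    using assms(2) unfolding algebra_hom_def
    by (auto intro!: bcontfun_eqI simp: ap times_bcontfun.rep_eq scaleC_bcontfun.rep_eq)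
  obtain K where K: "\<And>x. norm (\<sigma> x) \<le> norm x * K" "0 \<le> K"
    using bounded_linear.nonneg_bounded[OF algebra_hom_bounded_linear[OF assms(2,3)]] by blast
  have "bounded_linear (comp_bcontfun \<sigma> :: ('x \<Rightarrow>\<^sub>C 'a) \<Rightarrow> _)"
  proof (rule bounded_linear_intro)
    fix f g :: "'x \<Rightarrow>\<^sub>C 'a" and r :: real
    show "comp_bcontfun \<sigma> (f + g) = comp_bcontfun \<sigma> f + comp_bcontfun \<sigma> g"
      "comp_bcontfun \<sigma> (r *\<^sub>R f) = r *\<^sub>R comp_bcontfun \<sigma> f"
      using hom by (auto simp: algebra_hom_def scaleR_scaleC)
    show "norm (comp_bcontfun \<sigma> f) \<le> norm f * K"
    proof (rule norm_bound)
      fix x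
      have "norm (\<sigma> (f x)) \<le> norm (f x) * K" by (rule K)
      also have "\<dots> \<le> norm f * K" using K(2) by (intro mult_right_mono norm_bounded)
      finally show "norm (apply_bcontfun (comp_bcontfun \<sigma> f) x) \<le> norm f * K" by (simp add: ap)
    qed
  qed
  then show "continuous_on UNIV (comp_bcontfun \<sigma> :: ('x \<Rightarrow>\<^sub>C 'a) \<Rightarrow> _)"
    by (rule linear_continuous_on)
qed


section \<open>The algebraic tensor product\<close>

text \<open>
  A list of pairs \<open>(a\<^sub>i, b\<^sub>i)\<close> stands for the finite sum of the \<open>a\<^sub>i \<otimes> b\<^sub>i\<close>; scalar
  coefficients are absorbed into the first factor. Two lists are identified when this follows
  from the bilinearity relations. The rule \<open>zero\<close> is needed since formal sums of pairs
  form only a monoid; negatives then arise as \<open>(- a) \<otimes> b\<close>.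
\<close>

inductive tensor_eq ::
    "('a::complex_vector \<times> 'b::complex_vector) list \<Rightarrow> ('a \<times> 'b) list \<Rightarrow> bool"
  where
    refl: "tensor_eq xs xs"
  | sym: "tensor_eq xs ys \<Longrightarrow> tensor_eq ys xs"
  | trans: "tensor_eq xs ys \<Longrightarrow> tensor_eq ys zs \<Longrightarrow> tensor_eq xs zs"
  | append: "tensor_eq xs xs' \<Longrightarrow> tensor_eq ys ys' \<Longrightarrow> tensor_eq (xs @ ys) (xs' @ ys')"
  | commute: "tensor_eq (xs @ ys) (ys @ xs)"
  | zero: "tensor_eq [(0, b)] []"
  | add_left: "tensor_eq [(a + a', b)] [(a, b), (a', b)]"
  | add_right: "tensor_eq [(a, b + b')] [(a, b), (a, b')]"
  | scale: "tensor_eq [(c *\<^sub>C a, b)] [(a, c *\<^sub>C b)]"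

quotient_type (overloaded) ('a, 'b) tensor =
  "('a::complex_vector \<times> 'b::complex_vector) list" / tensor_eq
  by (rule equivpI) (auto intro!: reflpI sympI transpI intro: tensor_eq.intros)

lemma tensor_eq_map_left:
  assumes "tensor_eq xs ys"
    and "\<And>a a'. h (a + a') = h a + h a'" "\<And>c a. h (c *\<^sub>C a) = c *\<^sub>C h a"
  shows "tensor_eq (map (\<lambda>(a, b). (h a, b)) xs) (map (\<lambda>(a, b). (h a, b)) ys)"
  using assms(1)
proof induction
  case (zero b)
  have "h 0 = 0" using assms(3)[of 0 0] by (simp add: scaleC_zero_left)
  then show ?case by (simp add: tensor_eq.zero)
next
  case (trans xs ys zs)
  then show ?case by (blast intro: tensor_eq.trans)
qed (auto simp: assms(2,3) intro: tensor_eq.intros)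

instantiation tensor :: (complex_vector, complex_vector) complex_vector
begin

lift_definition zero_tensor :: "('a, 'b) tensor" is "[]" .

lift_definition plus_tensor :: "('a, 'b) tensor \<Rightarrow> ('a, 'b) tensor \<Rightarrow> ('a, 'b) tensor" is "(@)"
  by (rule tensor_eq.append)

lift_definition scaleC_tensor :: "complex \<Rightarrow> ('a, 'b) tensor \<Rightarrow> ('a, 'b) tensor"
  is "\<lambda>c. map (\<lambda>(a, b). (c *\<^sub>C a, b))"
  by (rule tensor_eq_map_left)
    (simp_all add: scaleC_add_right scaleC_scaleC mult.commute)

definition scaleR_tensor :: "real \<Rightarrow> ('a, 'b) tensor \<Rightarrow> ('a, 'b) tensor"
  where "scaleR_tensor r t = complex_of_real r *\<^sub>C t"

definition uminus_tensor :: "('a, 'b) tensor \<Rightarrow> ('a, 'b) tensor"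
  where "uminus_tensor t = (-1) *\<^sub>C t"

definition minus_tensor :: "('a, 'b) tensor \<Rightarrow> ('a, 'b) tensor \<Rightarrow> ('a, 'b) tensor"
  where "minus_tensor s t = s + (-1) *\<^sub>C t"

instance
proof -
  have comm: "s + t = t + s" for s t :: "('a, 'b) tensor"
    by transfer (rule tensor_eq.commute)
  have assoc: "s + t + u = s + (t + u)" for s t u :: "('a, 'b) tensor"
    by transfer (simp add: tensor_eq.refl)
  have zero: "0 + t = t" for t :: "('a, 'b) tensor"
    by transfer (simp add: tensor_eq.refl)
  have sadd: "c *\<^sub>C (s + t) = c *\<^sub>C s + c *\<^sub>C t" for c and s t :: "('a, 'b) tensor"
    by transfer (simp add: tensor_eq.refl)
  have sadd': "(c + d) *\<^sub>C t = c *\<^sub>C t + d *\<^sub>C t" for c d and t :: "('a, 'b) tensor"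
  proof (transfer fixing: c d)
    fix xs :: "('a \<times> 'b) list"
    let ?m = "\<lambda>c. map (\<lambda>(a::'a, b::'b). (c *\<^sub>C a, b))"
    show "tensor_eq (?m (c + d) xs) (?m c xs @ ?m d xs)"
    proof (induction xs)
      case Nil
      then show ?case by (simp add: tensor_eq.refl)
    next
      case (Cons p xs)
      obtain a b where p: "p = (a, b)" by (cases p)
      have "tensor_eq (?m (c + d) (p # xs)) ([(c *\<^sub>C a, b), (d *\<^sub>C a, b)] @ (?m c xs @ ?m d xs))"
        using tensor_eq.append[OF tensor_eq.add_left[of "c *\<^sub>C a" "d *\<^sub>C a" b] Cons.IH]
        by (simp add: p scaleC_add_left)
      moreover have "tensor_eq ([(c *\<^sub>C a, b)] @ (([(d *\<^sub>C a, b)] @ ?m c xs) @ ?m d xs))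
          ([(c *\<^sub>C a, b)] @ ((?m c xs @ [(d *\<^sub>C a, b)]) @ ?m d xs))"
        by (intro tensor_eq.append tensor_eq.refl tensor_eq.commute)
      ultimately show ?case by (auto simp: p intro: tensor_eq.trans)
    qed
  qed
  have zeroC: "0 *\<^sub>C t = 0" for t :: "('a, 'b) tensor"
  proof transfer
    fix xs :: "('a \<times> 'b) list"
    show "tensor_eq (map (\<lambda>(a, b). (0 *\<^sub>C a, b)) xs) []"
    proof (induction xs)
      case Nil
      then show ?case by (simp add: tensor_eq.refl)
    next
      case (Cons p xs)
      obtain a b where p: "p = (a, b)" by (cases p)
      show ?case
        using tensor_eq.append[OF tensor_eq.zero[of b] Cons.IH] by (simp add: p scaleC_zero_left)
    qed
  qed
  have oneC: "1 *\<^sub>C t = t" for t :: "('a, 'b) tensor"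
  proof transfer
    fix xs :: "('a \<times> 'b) list"
    have "map (\<lambda>(a, b). (1 *\<^sub>C a, b)) xs = xs"
      by (induction xs) (auto simp: scaleC_one)
    then show "tensor_eq (map (\<lambda>(a, b). (1 *\<^sub>C a, b)) xs) xs" by (simp add: tensor_eq.refl)
  qed
  have ss: "c *\<^sub>C (d *\<^sub>C t) = (c * d) *\<^sub>C t" for c d and t :: "('a, 'b) tensor"
  proof (transfer fixing: c d)
    fix xs :: "('a \<times> 'b) list"
    have "map (\<lambda>(a, b). (c *\<^sub>C a, b)) (map (\<lambda>(a, b). (d *\<^sub>C a, b)) xs) =
        map (\<lambda>(a, b). ((c * d) *\<^sub>C a, b)) xs"
      by (induction xs) (auto simp: scaleC_scaleC)
    then show "tensor_eq (map (\<lambda>(a, b). (c *\<^sub>C a, b)) (map (\<lambda>(a, b). (d *\<^sub>C a, b)) xs))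
        (map (\<lambda>(a, b). ((c * d) *\<^sub>C a, b)) xs)" by (simp only: tensor_eq.refl)
  qed
  have neg: "(-1) *\<^sub>C t + t = 0" for t :: "('a, 'b) tensor"
    using sadd'[of "-1" 1 t] by (simp add: oneC zeroC)
  show "OFCLASS(('a, 'b) tensor, complex_vector_class)"
    by standard
      (use comm assoc zero sadd sadd' oneC ss neg in
        \<open>auto simp: scaleR_tensor_def uminus_tensor_def minus_tensor_def\<close>)
qed

end

lift_definition elem_tensor :: "'a::complex_vector \<Rightarrow> 'b::complex_vector \<Rightarrow> ('a, 'b) tensor"
  is "\<lambda>a b. [(a, b)]" .

lemma abs_tensor_Cons: "abs_tensor ((a, b) # xs) = elem_tensor a b + abs_tensor xs"
  by (simp add: elem_tensor.abs_eq plus_tensor.abs_eq)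

lemma abs_tensor_Nil: "abs_tensor [] = 0"
  by (simp add: zero_tensor_def)

text \<open>The projective norm of \<open>t\<close> is the infimum of the sums of the \<open>\<parallel>a\<^sub>i\<parallel> \<parallel>b\<^sub>i\<parallel>\<close> over all
  representations of \<open>t\<close> as a finite sum of the \<open>a\<^sub>i \<otimes> b\<^sub>i\<close>.\<close>

definition rep_cost :: "('a::real_normed_vector \<times> 'b::real_normed_vector) list \<Rightarrow> real"
  where "rep_cost xs = (\<Sum>(a, b)\<leftarrow>xs. norm a * norm b)"

definition proj_norm :: "('a::complex_normed_vector, 'b::complex_normed_vector) tensor \<Rightarrow> real"
  where "proj_norm t = (INF xs\<in>{xs. abs_tensor xs = t}. rep_cost xs)"

lemma rep_cost_nonneg: "rep_cost xs \<ge> 0"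
  unfolding rep_cost_def by (induction xs) auto

lemma rep_cost_append: "rep_cost (xs @ ys) = rep_cost xs + rep_cost ys"
  by (simp add: rep_cost_def)

lemma bdd_below_rep_cost: "bdd_below (rep_cost ` S)"
  using rep_cost_nonneg by (auto intro!: bdd_belowI)

lemma tensor_rep_nonempty: "{xs. abs_tensor xs = t} \<noteq> {}"
  by (metis (mono_tags, lifting) Quotient3_abs_rep Quotient3_tensor empty_iff mem_Collect_eq)

lemma tensor_cases: obtains xs where "t = abs_tensor xs"
  using tensor_rep_nonempty[of t] by blast

lemma proj_norm_le: "abs_tensor xs = t \<Longrightarrow> proj_norm t \<le> rep_cost xs"
  unfolding proj_norm_def by (rule cINF_lower[OF bdd_below_rep_cost]) simp

lemma proj_norm_approx:
  assumes "e > 0"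
  obtains xs where "abs_tensor xs = t" "rep_cost xs < proj_norm t + e"
proof -
  have "\<exists>xs\<in>{xs. abs_tensor xs = t}. rep_cost xs < proj_norm t + e"
    using assms
    by (subst cINF_less_iff[symmetric, OF tensor_rep_nonempty bdd_below_rep_cost])
      (simp add: proj_norm_def)
  then show ?thesis using that by auto
qed

lemma proj_norm_nonneg: "proj_norm t \<ge> 0"
  unfolding proj_norm_def by (rule cINF_greatest[OF tensor_rep_nonempty rep_cost_nonneg])

lemma proj_norm_zero: "proj_norm (0 :: ('a::complex_normed_vector, 'b::complex_normed_vector) tensor) = 0"
  using proj_norm_le[OF abs_tensor_Nil, where ?'a='a and ?'b='b] proj_norm_nonneg[of "0 :: ('a, 'b) tensor"]
  by (auto simp: rep_cost_def)

lemma proj_norm_triangle: "proj_norm (s + t) \<le> proj_norm s + proj_norm t"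
proof (rule field_le_epsilon)
  fix e :: real assume "e > 0"
  then have "e / 2 > 0" by simp
  obtain xs where xs: "abs_tensor xs = s" "rep_cost xs < proj_norm s + e / 2"
    using proj_norm_approx[OF \<open>e / 2 > 0\<close>] .
  obtain ys where ys: "abs_tensor ys = t" "rep_cost ys < proj_norm t + e / 2"
    using proj_norm_approx[OF \<open>e / 2 > 0\<close>] .
  have "abs_tensor (xs @ ys) = s + t" using xs ys by (auto simp: plus_tensor.abs_eq)
  then have "proj_norm (s + t) \<le> rep_cost xs + rep_cost ys"
    using proj_norm_le rep_cost_append by metis
  then show "proj_norm (s + t) \<le> proj_norm s + proj_norm t + e" using xs ys by simp
qed

lemma rep_cost_scaleC:
  fixes xs :: "('a::complex_normed_vector \<times> 'b::complex_normed_vector) list"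
  shows "rep_cost (map (\<lambda>(a, b). (c *\<^sub>C a, b)) xs) = cmod c * rep_cost xs"
  unfolding rep_cost_def by (induction xs) (auto simp: norm_scaleC algebra_simps)

lemma proj_norm_scaleC: "proj_norm (c *\<^sub>C t) = cmod c * proj_norm t"
proof -
  have le: "proj_norm (c *\<^sub>C t) \<le> cmod c * proj_norm t" for c and t :: "('a, 'b) tensor"
  proof (rule field_le_epsilon)
    fix e :: real assume e: "e > 0"
    define d where "d = e / (cmod c + 1)"
    have cpos: "cmod c + 1 > 0" by (smt (verit) norm_ge_zero)
    have d: "d > 0" "cmod c * d \<le> e"
      using e cpos by (auto simp: d_def field_simps)
    obtain xs where xs: "abs_tensor xs = t" "rep_cost xs < proj_norm t + d"
      using proj_norm_approx[OF d(1)] .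
    have "abs_tensor (map (\<lambda>(a, b). (c *\<^sub>C a, b)) xs) = c *\<^sub>C t"
      using xs(1) scaleC_tensor.abs_eq by metis
    then have "proj_norm (c *\<^sub>C t) \<le> cmod c * rep_cost xs"
      using proj_norm_le rep_cost_scaleC by metis
    also have "\<dots> \<le> cmod c * (proj_norm t + d)" using xs(2) by (intro mult_left_mono) auto
    also have "\<dots> \<le> cmod c * proj_norm t + e" using d(2) by (simp add: algebra_simps)
    finally show "proj_norm (c *\<^sub>C t) \<le> cmod c * proj_norm t + e" .
  qed
  show ?thesis
  proof (cases "c = 0")
    case True
    then show ?thesis by (simp add: scaleC_zero_left proj_norm_zero)
  next
    case False
    have "proj_norm t \<le> cmod (inverse c) * proj_norm (c *\<^sub>C t)"
      using le[of "inverse c" "c *\<^sub>C t"] False by (simp add: scaleC_scaleC scaleC_one)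
    then have "cmod c * proj_norm t \<le> proj_norm (c *\<^sub>C t)"
      using False by (simp add: norm_inverse norm_divide field_simps)
    then show ?thesis using le[of c t] by simp
  qed
qed

lemma proj_norm_uminus: "proj_norm (- t) = proj_norm t"
  using proj_norm_scaleC[of "-1" t] by (simp add: scaleC_minus_one)

lemma proj_norm_minus_commute: "proj_norm (s - t) = proj_norm (t - s)"
  using proj_norm_uminus[of "s - t"] by simp

lemma proj_norm_diff_triangle: "\<bar>proj_norm s - proj_norm t\<bar> \<le> proj_norm (s - t)"
  using proj_norm_triangle[of "s - t" t] proj_norm_triangle[of "t - s" s]
    proj_norm_minus_commute[of s t] by simp

lemma proj_norm_elem_tensor: "proj_norm (elem_tensor a b) \<le> norm a * norm b"
  using proj_norm_le[of "[(a, b)]" "elem_tensor a b"]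
  by (simp add: elem_tensor.abs_eq rep_cost_def)

lemma elem_tensor_simps:
  "elem_tensor (a + a') b = elem_tensor a b + elem_tensor a' b"
  "elem_tensor a (b + b') = elem_tensor a b + elem_tensor a b'"
  "elem_tensor (c *\<^sub>C a) b = c *\<^sub>C elem_tensor a b"
  "elem_tensor a (c *\<^sub>C b) = c *\<^sub>C elem_tensor a b"
     apply (transfer, simp add: tensor_eq.add_left)
    apply (transfer, simp add: tensor_eq.add_right)
   apply (transfer, simp add: tensor_eq.refl)
  apply (transfer, simp, blast intro: tensor_eq.sym tensor_eq.scale)
  done

lifting_update tensor.lifting
lifting_forget tensor.lifting


section \<open>The projective tensor product\<close>

text \<open>
  The completion of the algebraic tensor product, as Cauchy sequences modulo null sequences.
  That the projective norm is definite on the algebraic tensor product is not needed for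
  this construction.
\<close>

definition proj_Cauchy :: "(nat \<Rightarrow> ('a::complex_normed_vector, 'b::complex_normed_vector) tensor) \<Rightarrow> bool"
  where "proj_Cauchy x \<longleftrightarrow> (\<forall>e>0. \<exists>N. \<forall>m\<ge>N. \<forall>n\<ge>N. proj_norm (x m - x n) < e)"

definition ptensor_eq ::
    "(nat \<Rightarrow> ('a::complex_normed_vector, 'b::complex_normed_vector) tensor) \<Rightarrow> (nat \<Rightarrow> ('a, 'b) tensor) \<Rightarrow> bool"
  where "ptensor_eq x y \<longleftrightarrow> proj_Cauchy x \<and> proj_Cauchy y \<and> (\<lambda>n. proj_norm (x n - y n)) \<longlonglongrightarrow> 0"

lemma proj_null_le:
  assumes "(\<lambda>n. f n) \<longlonglongrightarrow> (0::real)" "\<And>n. proj_norm (x n) \<le> f n"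
  shows "(\<lambda>n. proj_norm (x n)) \<longlonglongrightarrow> 0"
  by (rule tendsto_sandwich[OF _ _ tendsto_const assms(1)])
    (use assms(2) proj_norm_nonneg in \<open>auto intro!: always_eventually\<close>)

lemma proj_Cauchy_const: "proj_Cauchy (\<lambda>_. t)"
  by (auto simp: proj_Cauchy_def proj_norm_zero)

lemma ptensor_eq_refl: "ptensor_eq x x \<longleftrightarrow> proj_Cauchy x"
  by (auto simp: ptensor_eq_def proj_norm_zero)

lemma ptensor_eq_sym: "ptensor_eq x y \<Longrightarrow> ptensor_eq y x"
  by (auto simp: ptensor_eq_def proj_norm_minus_commute)

lemma ptensor_eq_trans:
  assumes "ptensor_eq x y" "ptensor_eq y z"
  shows "ptensor_eq x z"
proof -
  have "(\<lambda>n. proj_norm (x n - y n) + proj_norm (y n - z n)) \<longlonglongrightarrow> 0"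
    using assms tendsto_add[of _ 0 _ _ 0] by (fastforce simp: ptensor_eq_def)
  moreover have "proj_norm (x n - z n) \<le> proj_norm (x n - y n) + proj_norm (y n - z n)" for n
    using proj_norm_triangle[of "x n - y n" "y n - z n"] by simp
  ultimately have "(\<lambda>n. proj_norm (x n - z n)) \<longlonglongrightarrow> 0"
    by (rule proj_null_le)
  then show ?thesis using assms by (auto simp: ptensor_eq_def)
qed

quotient_type (overloaded) ('a, 'b) ptensor =
  "nat \<Rightarrow> ('a::complex_normed_vector, 'b::complex_normed_vector) tensor" / partial: ptensor_eq
proof (rule part_equivpI)
  show "\<exists>x. ptensor_eq x x" using proj_Cauchy_const ptensor_eq_refl by blast
  show "symp ptensor_eq" by (rule sympI) (rule ptensor_eq_sym)
  show "transp ptensor_eq" by (rule transpI) (rule ptensor_eq_trans)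
qed

lemma proj_Cauchy_add:
  assumes "proj_Cauchy x" "proj_Cauchy y"
  shows "proj_Cauchy (\<lambda>n. x n + y n)"
  unfolding proj_Cauchy_def
proof (intro allI impI)
  fix e :: real assume "e > 0"
  then have "e / 2 > 0" by simp
  obtain M where M: "\<And>m n. m \<ge> M \<Longrightarrow> n \<ge> M \<Longrightarrow> proj_norm (x m - x n) < e / 2"
    using assms(1) \<open>e / 2 > 0\<close> unfolding proj_Cauchy_def by meson
  obtain N where N: "\<And>m n. m \<ge> N \<Longrightarrow> n \<ge> N \<Longrightarrow> proj_norm (y m - y n) < e / 2"
    using assms(2) \<open>e / 2 > 0\<close> unfolding proj_Cauchy_def by meson
  have "proj_norm (x m + y m - (x n + y n)) < e" if "m \<ge> max M N" "n \<ge> max M N" for m n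
    using M[of m n] N[of m n] that proj_norm_triangle[of "x m - x n" "y m - y n"]
    by (simp add: algebra_simps)
  then show "\<exists>N. \<forall>m\<ge>N. \<forall>n\<ge>N. proj_norm (x m + y m - (x n + y n)) < e" by blast
qed

lemma proj_Cauchy_scaleC:
  assumes "proj_Cauchy x"
  shows "proj_Cauchy (\<lambda>n. c *\<^sub>C x n)"
  unfolding proj_Cauchy_def
proof (intro allI impI)
  fix e :: real assume e: "e > 0"
  have cpos: "cmod c + 1 > 0" by (smt (verit) norm_ge_zero)
  then have "e / (cmod c + 1) > 0" using e by simp
  then obtain N where N: "\<And>m n. m \<ge> N \<Longrightarrow> n \<ge> N \<Longrightarrow> proj_norm (x m - x n) < e / (cmod c + 1)"
    using assms unfolding proj_Cauchy_def by meson
  have "proj_norm (c *\<^sub>C x m - c *\<^sub>C x n) < e" if "m \<ge> N" "n \<ge> N" for m n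
  proof -
    have "proj_norm (c *\<^sub>C x m - c *\<^sub>C x n) = cmod c * proj_norm (x m - x n)"
      using proj_norm_scaleC[of c "x m - x n"] by (simp add: scaleC_diff_right)
    also have "\<dots> \<le> (cmod c + 1) * proj_norm (x m - x n)"
      by (intro mult_right_mono proj_norm_nonneg) simp
    also have "\<dots> < e" using N[OF that] cpos by (simp add: field_simps)
    finally show ?thesis .
  qed
  then show "\<exists>N. \<forall>m\<ge>N. \<forall>n\<ge>N. proj_norm (c *\<^sub>C x m - c *\<^sub>C x n) < e" by blast
qed

lemma proj_Cauchy_convergent:
  assumes "proj_Cauchy x"
  shows "convergent (\<lambda>n. proj_norm (x n))"
proof -
  have "Cauchy (\<lambda>n. proj_norm (x n))"
    using assms proj_norm_diff_triangle unfolding proj_Cauchy_def Cauchy_def dist_real_def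
    by (meson le_less_trans)
  then show ?thesis by (simp add: Cauchy_convergent)
qed

instantiation ptensor :: (complex_normed_vector, complex_normed_vector) complex_vector
begin

lift_definition zero_ptensor :: "('a, 'b) ptensor" is "\<lambda>_. 0"
  by (simp add: ptensor_eq_refl proj_Cauchy_const)

lift_definition plus_ptensor :: "('a, 'b) ptensor \<Rightarrow> ('a, 'b) ptensor \<Rightarrow> ('a, 'b) ptensor"
  is "\<lambda>x y n. x n + y n"
proof -
  fix x x' y y' :: "nat \<Rightarrow> ('a, 'b) tensor"
  assume x: "ptensor_eq x x'" and y: "ptensor_eq y y'"
  have "(\<lambda>n. proj_norm (x n - x' n) + proj_norm (y n - y' n)) \<longlonglongrightarrow> 0"
    using x y tendsto_add[of _ 0 _ _ 0] by (fastforce simp: ptensor_eq_def)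
  moreover have "proj_norm (x n + y n - (x' n + y' n)) \<le> proj_norm (x n - x' n) + proj_norm (y n - y' n)" for n
    using proj_norm_triangle[of "x n - x' n" "y n - y' n"] by (simp add: algebra_simps)
  ultimately have "(\<lambda>n. proj_norm (x n + y n - (x' n + y' n))) \<longlonglongrightarrow> 0"
    by (rule proj_null_le)
  then show "ptensor_eq (\<lambda>n. x n + y n) (\<lambda>n. x' n + y' n)"
    using x y by (auto simp: ptensor_eq_def intro: proj_Cauchy_add)
qed

lift_definition scaleC_ptensor :: "complex \<Rightarrow> ('a, 'b) ptensor \<Rightarrow> ('a, 'b) ptensor"
  is "\<lambda>c x n. c *\<^sub>C x n"
proof -
  fix c and x x' :: "nat \<Rightarrow> ('a, 'b) tensor"
  assume x: "ptensor_eq x x'"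
  then have "(\<lambda>n. cmod c * proj_norm (x n - x' n)) \<longlonglongrightarrow> 0"
    by (auto simp: ptensor_eq_def intro: tendsto_mult_right_zero)
  then have "(\<lambda>n. proj_norm (c *\<^sub>C x n - c *\<^sub>C x' n)) \<longlonglongrightarrow> 0"
    by (simp add: proj_norm_scaleC flip: scaleC_diff_right)
  then show "ptensor_eq (\<lambda>n. c *\<^sub>C x n) (\<lambda>n. c *\<^sub>C x' n)"
    using x by (auto simp: ptensor_eq_def intro: proj_Cauchy_scaleC)
qed

definition scaleR_ptensor :: "real \<Rightarrow> ('a, 'b) ptensor \<Rightarrow> ('a, 'b) ptensor"
  where "scaleR_ptensor r t = complex_of_real r *\<^sub>C t"

definition uminus_ptensor :: "('a, 'b) ptensor \<Rightarrow> ('a, 'b) ptensor"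
  where "uminus_ptensor t = (-1) *\<^sub>C t"

definition minus_ptensor :: "('a, 'b) ptensor \<Rightarrow> ('a, 'b) ptensor \<Rightarrow> ('a, 'b) ptensor"
  where "minus_ptensor s t = s + (-1) *\<^sub>C t"

instance
proof -
  have *: "ptensor_eq x y" if "proj_Cauchy x" "\<And>n. x n = y n" for x y :: "nat \<Rightarrow> ('a, 'b) tensor"
  proof -
    have "x = y" using that(2) by auto
    then show ?thesis using that(1) by (simp add: ptensor_eq_refl)
  qed
  note C = ptensor_eq_refl proj_Cauchy_add proj_Cauchy_scaleC proj_Cauchy_const
  have comm: "s + t = t + s" for s t :: "('a, 'b) ptensor"
    by transfer (rule *, auto simp: C add.commute)
  have assoc: "s + t + u = s + (t + u)" for s t u :: "('a, 'b) ptensor"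
    by transfer (rule *, auto simp: C add.assoc)
  have zero: "0 + t = t" for t :: "('a, 'b) ptensor"
    by transfer (rule *, auto simp: C)
  have sadd: "c *\<^sub>C (s + t) = c *\<^sub>C s + c *\<^sub>C t" for c and s t :: "('a, 'b) ptensor"
    by transfer (rule *, auto simp: C scaleC_add_right)
  have sadd': "(c + d) *\<^sub>C t = c *\<^sub>C t + d *\<^sub>C t" for c d and t :: "('a, 'b) ptensor"
    by transfer (rule *, auto simp: C scaleC_add_left)
  have zeroC: "0 *\<^sub>C t = 0" for t :: "('a, 'b) ptensor"
    by transfer (rule *, auto simp: C scaleC_zero_left)
  have oneC: "1 *\<^sub>C t = t" for t :: "('a, 'b) ptensor"
    by transfer (rule *, auto simp: C scaleC_one)
  have ss: "c *\<^sub>C (d *\<^sub>C t) = (c * d) *\<^sub>C t" for c d and t :: "('a, 'b) ptensor"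
    by transfer (rule *, auto simp: C scaleC_scaleC)
  have neg: "(-1) *\<^sub>C t + t = 0" for t :: "('a, 'b) ptensor"
    using sadd'[of "-1" 1 t] by (simp add: oneC zeroC)
  show "OFCLASS(('a, 'b) ptensor, complex_vector_class)"
    by standard
      (use comm assoc zero sadd sadd' oneC ss neg in
        \<open>auto simp: scaleR_ptensor_def uminus_ptensor_def minus_ptensor_def\<close>)
qed

end

instantiation ptensor :: (complex_normed_vector, complex_normed_vector) complex_normed_vector
begin

lift_definition norm_ptensor :: "('a, 'b) ptensor \<Rightarrow> real" is "\<lambda>x. lim (\<lambda>n. proj_norm (x n))"
proof -
  fix x y :: "nat \<Rightarrow> ('a, 'b) tensor"
  assume xy: "ptensor_eq x y"
  obtain l where l: "(\<lambda>n. proj_norm (x n)) \<longlonglongrightarrow> l"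
    using xy proj_Cauchy_convergent by (auto simp: ptensor_eq_def convergent_def)
  have "(\<lambda>n. proj_norm (x n) - proj_norm (y n)) \<longlonglongrightarrow> 0"
    by (rule tendsto_0_le[where K = 1 and f = "\<lambda>n. proj_norm (x n - y n)"])
      (use xy proj_norm_diff_triangle in \<open>auto simp: ptensor_eq_def proj_norm_nonneg intro!: always_eventually\<close>)
  from tendsto_diff[OF l this] have "(\<lambda>n. proj_norm (y n)) \<longlonglongrightarrow> l" by simp
  with l show "lim (\<lambda>n. proj_norm (x n)) = lim (\<lambda>n. proj_norm (y n))"
    by (simp add: limI)
qed

definition dist_ptensor :: "('a, 'b) ptensor \<Rightarrow> ('a, 'b) ptensor \<Rightarrow> real"
  where "dist_ptensor s t = norm (s - t)"

definition sgn_ptensor :: "('a, 'b) ptensor \<Rightarrow> ('a, 'b) ptensor"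
  where "sgn_ptensor t = t /\<^sub>R norm t"

definition uniformity_ptensor :: "(('a, 'b) ptensor \<times> ('a, 'b) ptensor) filter"
  where "uniformity_ptensor = (INF e\<in>{0<..}. principal {(x, y). dist x y < e})"

definition open_ptensor :: "('a, 'b) ptensor set \<Rightarrow> bool"
  where "open_ptensor U \<longleftrightarrow> (\<forall>x\<in>U. \<forall>\<^sub>F (x', y) in uniformity. x' = x \<longrightarrow> y \<in> U)"

instance
proof -
  note C = ptensor_eq_refl proj_Cauchy_add proj_Cauchy_scaleC proj_Cauchy_const
  have lim: "(\<lambda>n. proj_norm (x n)) \<longlonglongrightarrow> lim (\<lambda>n. proj_norm (x n))"
    if "ptensor_eq x x" for x :: "nat \<Rightarrow> ('a, 'b) tensor"
    using that proj_Cauchy_convergent convergent_LIMSEQ_iff by (auto simp: ptensor_eq_refl)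
  have triangle: "norm (s + t) \<le> norm s + norm t" for s t :: "('a, 'b) ptensor"
  proof transfer
    fix x y :: "nat \<Rightarrow> ('a, 'b) tensor"
    assume x: "ptensor_eq x x" and y: "ptensor_eq y y"
    then have xy: "ptensor_eq (\<lambda>n. x n + y n) (\<lambda>n. x n + y n)" by (simp add: C)
    show "lim (\<lambda>n. proj_norm (x n + y n)) \<le> lim (\<lambda>n. proj_norm (x n)) + lim (\<lambda>n. proj_norm (y n))"
      by (rule LIMSEQ_le[OF lim[OF xy] tendsto_add[OF lim[OF x] lim[OF y]]])
        (auto intro: proj_norm_triangle)
  qed
  have scale: "norm (c *\<^sub>C t) = cmod c * norm t" for c and t :: "('a, 'b) ptensor"
  proof transfer
    fix c and x :: "nat \<Rightarrow> ('a, 'b) tensor"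
    assume x: "ptensor_eq x x"
    show "lim (\<lambda>n. proj_norm (c *\<^sub>C x n)) = cmod c * lim (\<lambda>n. proj_norm (x n))"
      by (rule limI) (simp add: proj_norm_scaleC tendsto_mult_left[OF lim[OF x]])
  qed
  have definite: "norm t = 0 \<longleftrightarrow> t = 0" for t :: "('a, 'b) ptensor"
  proof transfer
    fix x :: "nat \<Rightarrow> ('a, 'b) tensor"
    assume x: "ptensor_eq x x"
    show "lim (\<lambda>n. proj_norm (x n)) = 0 \<longleftrightarrow> ptensor_eq x (\<lambda>_. 0)"
    proof
      assume "lim (\<lambda>n. proj_norm (x n)) = 0"
      then show "ptensor_eq x (\<lambda>_. 0)"
        using lim[OF x] x by (simp add: ptensor_eq_def proj_Cauchy_const)
    next
      assume "ptensor_eq x (\<lambda>_. 0)"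
      then show "lim (\<lambda>n. proj_norm (x n)) = 0" by (simp add: ptensor_eq_def limI)
    qed
  qed
  show "OFCLASS(('a, 'b) ptensor, complex_normed_vector_class)"
  proof
    fix s t :: "('a, 'b) ptensor" and r :: real and c :: complex
    show "dist s t = norm (s - t)" by (rule dist_ptensor_def)
    show "sgn t = t /\<^sub>R norm t" by (rule sgn_ptensor_def)
    show "(uniformity :: (('a, 'b) ptensor \<times> _) filter) = (INF e\<in>{0<..}. principal {(x, y). dist x y < e})"
      by (rule uniformity_ptensor_def)
    show "open U \<longleftrightarrow> (\<forall>x\<in>U. \<forall>\<^sub>F (x', y) in uniformity. x' = x \<longrightarrow> y \<in> U)" for U :: "('a, 'b) ptensor set"
      by (rule open_ptensor_def)
    show "norm (r *\<^sub>R t) = \<bar>r\<bar> * norm t" by (simp add: scaleR_ptensor_def scale)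
    show "norm (c *\<^sub>C t) = cmod c * norm t" by (rule scale)
    show "norm t = 0 \<longleftrightarrow> t = 0" by (rule definite)
    show "norm (s + t) \<le> norm s + norm t" by (rule triangle)
  qed
qed

end

lift_definition of_tensor ::
    "('a::complex_normed_vector, 'b::complex_normed_vector) tensor \<Rightarrow> ('a, 'b) ptensor" is "\<lambda>t _. t"
  by (simp add: ptensor_eq_refl proj_Cauchy_const)

lemma of_tensor_add: "of_tensor (s + t) = of_tensor s + of_tensor t"
  by transfer (simp add: ptensor_eq_refl proj_Cauchy_const)

lemma of_tensor_scaleC: "of_tensor (c *\<^sub>C t) = c *\<^sub>C of_tensor t"
  by transfer (simp add: ptensor_eq_refl proj_Cauchy_const)

lemma of_tensor_zero: "of_tensor 0 = 0"
  by transfer (simp add: ptensor_eq_refl proj_Cauchy_const)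

lemma of_tensor_diff: "of_tensor (s - t) = of_tensor s - of_tensor t"
  by (metis of_tensor_add add_diff_cancel_right' diff_add_cancel)

lemma norm_of_tensor: "norm (of_tensor t) = proj_norm t"
  by transfer (simp add: limI)

lemma abs_ptensor_limit:
  assumes "proj_Cauchy x"
  shows "(\<lambda>n. of_tensor (x n)) \<longlonglongrightarrow> abs_ptensor x"
proof (rule LIMSEQ_I)
  fix e :: real assume "e > 0"
  then have "e / 2 > 0" by simp
  then obtain N where N: "\<And>m n. m \<ge> N \<Longrightarrow> n \<ge> N \<Longrightarrow> proj_norm (x m - x n) < e / 2"
    using assms unfolding proj_Cauchy_def by meson
  have "norm (of_tensor (x n) - abs_ptensor x) < e" if n: "n \<ge> N" for n
  proof -
    have Cx: "proj_Cauchy (\<lambda>k. (-1) *\<^sub>C x k)" by (rule proj_Cauchy_scaleC[OF assms])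
    have C: "proj_Cauchy (\<lambda>k. x n + (-1) *\<^sub>C x k)"
      by (rule proj_Cauchy_add[OF proj_Cauchy_const Cx])
    have "of_tensor (x n) - abs_ptensor x = abs_ptensor (\<lambda>k. x n + (-1) *\<^sub>C x k)"
      using Cx by (simp add: minus_ptensor_def of_tensor.abs_eq scaleC_ptensor.abs_eq
          plus_ptensor.abs_eq ptensor_eq_refl proj_Cauchy_const assms)
    then have eq: "norm (of_tensor (x n) - abs_ptensor x) = lim (\<lambda>k. proj_norm (x n - x k))"
      using C by (simp add: norm_ptensor.abs_eq ptensor_eq_refl scaleC_minus_one)
    have "(\<lambda>k. proj_norm (x n - x k)) \<longlonglongrightarrow> lim (\<lambda>k. proj_norm (x n - x k))"
      using proj_Cauchy_convergent[OF C] by (simp add: convergent_LIMSEQ_iff scaleC_minus_one)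
    then have "lim (\<lambda>k. proj_norm (x n - x k)) \<le> e / 2"
      by (rule LIMSEQ_le_const2) (use N n less_imp_le in blast)
    then show ?thesis using eq \<open>e > 0\<close> by simp
  qed
  then show "\<exists>N. \<forall>n\<ge>N. norm (of_tensor (x n) - abs_ptensor x) < e" by blast
qed

lemma ptensor_cases:
  obtains x where "proj_Cauchy x" "p = abs_ptensor x" "(\<lambda>n. of_tensor (x n)) \<longlonglongrightarrow> p"
proof -
  obtain x where "ptensor_eq x x" "p = abs_ptensor x"
    by (metis Quotient3_abs_rep Quotient3_ptensor Quotient3_rep_reflp)
  then show ?thesis using that abs_ptensor_limit by (auto simp: ptensor_eq_refl)
qed

instance ptensor :: (complex_normed_vector, complex_normed_vector) complex_banach
proof
  fix X :: "nat \<Rightarrow> ('a, 'b) ptensor"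
  assume X: "Cauchy X"
  have "\<exists>t. norm (of_tensor t - X n) < inverse (real (Suc n))" for n
  proof -
    obtain x where "(\<lambda>k. of_tensor (x k)) \<longlonglongrightarrow> X n" by (rule ptensor_cases)
    from LIMSEQ_D[OF this, of "inverse (real (Suc n))"] show ?thesis by auto
  qed
  then obtain t where t: "\<And>n. norm (of_tensor (t n) - X n) < inverse (real (Suc n))" by metis
  have null: "(\<lambda>n. of_tensor (t n) - X n) \<longlonglongrightarrow> 0"
    by (rule Lim_null_comparison[OF _ LIMSEQ_inverse_real_of_nat])
      (use t less_imp_le in \<open>auto intro!: always_eventually\<close>)
  have "Cauchy (\<lambda>n. of_tensor (t n))"
    unfolding Cauchy_def dist_norm
  proof (intro allI impI)
    fix e :: real assume "e > 0"
    then have "e / 2 > 0" by simp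
    obtain M where M: "\<And>m n. m \<ge> M \<Longrightarrow> n \<ge> M \<Longrightarrow>
        norm ((of_tensor (t m) - X m) - (of_tensor (t n) - X n)) < e / 2"
      using LIMSEQ_imp_Cauchy[OF null] \<open>e / 2 > 0\<close> unfolding Cauchy_def dist_norm by meson
    obtain N where N: "\<And>m n. m \<ge> N \<Longrightarrow> n \<ge> N \<Longrightarrow> norm (X m - X n) < e / 2"
      using X \<open>e / 2 > 0\<close> unfolding Cauchy_def dist_norm by meson
    have "norm (of_tensor (t m) - of_tensor (t n)) < e" if "m \<ge> max M N" "n \<ge> max M N" for m n
      using M[of m n] N[of m n] that
        norm_triangle_ineq[of "(of_tensor (t m) - X m) - (of_tensor (t n) - X n)" "X m - X n"]
      by simp
    then show "\<exists>N. \<forall>m\<ge>N. \<forall>n\<ge>N. norm (of_tensor (t m) - of_tensor (t n)) < e" by blast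
  qed
  then have "proj_Cauchy t"
    unfolding proj_Cauchy_def Cauchy_def dist_norm
    by (simp add: norm_of_tensor flip: of_tensor_diff)
  from tendsto_diff[OF abs_ptensor_limit[OF this] null] have "X \<longlonglongrightarrow> abs_ptensor t" by simp
  then show "convergent X" by (rule convergentI)
qed

definition elem_ptensor ::
    "'a::complex_normed_vector \<Rightarrow> 'b::complex_normed_vector \<Rightarrow> ('a, 'b) ptensor"  (infixl \<open>\<otimes>\<^sub>\<pi>\<close> 72)
  where "a \<otimes>\<^sub>\<pi> b = of_tensor (elem_tensor a b)"

lemma norm_elem_ptensor: "norm (a \<otimes>\<^sub>\<pi> b) \<le> norm a * norm b"
  by (simp add: elem_ptensor_def norm_of_tensor proj_norm_elem_tensor)

lemma bounded_cbilinear_elem_ptensor: "bounded_cbilinear (\<otimes>\<^sub>\<pi>)"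
  unfolding bounded_cbilinear_def
proof (intro conjI allI bounded_bilinear.intro)
  show "\<exists>K. \<forall>a b. norm (a \<otimes>\<^sub>\<pi> b) \<le> norm a * norm b * K"
    by (rule exI[of _ 1]) (simp add: norm_elem_ptensor)
qed (simp_all add: elem_ptensor_def elem_tensor_simps of_tensor_add of_tensor_scaleC scaleR_scaleC)

lemma of_tensor_abs_tensor: "of_tensor (abs_tensor xs) = (\<Sum>(a, b)\<leftarrow>xs. a \<otimes>\<^sub>\<pi> b)"
  by (induction xs)
    (auto simp: abs_tensor_Nil abs_tensor_Cons of_tensor_zero of_tensor_add elem_ptensor_def)

text \<open>The bounded linear map determined by its values \<open>\<phi> a b\<close> on elementary tensors.\<close>

definition ptensor_lift ::
    "('a::complex_normed_vector \<Rightarrow> 'b::complex_normed_vector \<Rightarrow> 'c::complex_banach) \<Rightarrow> ('a, 'b) ptensor \<Rightarrow> 'c"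
  where "ptensor_lift \<phi> = (THE T. bounded_clinear T \<and> (\<forall>a b. T (a \<otimes>\<^sub>\<pi> b) = \<phi> a b))"

lemma ptensor_lift_unique:
  fixes S T :: "('a::complex_normed_vector, 'b::complex_normed_vector) ptensor \<Rightarrow> 'c::complex_normed_vector"
  assumes "bounded_clinear S" "bounded_clinear T" "\<And>a b. S (a \<otimes>\<^sub>\<pi> b) = T (a \<otimes>\<^sub>\<pi> b)"
  shows "S = T"
proof
  fix p :: "('a, 'b) ptensor"
  interpret S: bounded_linear S using assms(1) by (simp add: bounded_clinear_def)
  interpret T: bounded_linear T using assms(2) by (simp add: bounded_clinear_def)
  have "S (of_tensor t) = T (of_tensor t)" for t
  proof -
    obtain xs where xs: "t = abs_tensor xs" by (rule tensor_cases)
    have "S (of_tensor (abs_tensor xs)) = T (of_tensor (abs_tensor xs))"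
      unfolding of_tensor_abs_tensor by (induction xs) (auto simp: S.add T.add assms(3))
    then show ?thesis using xs by simp
  qed
  then have eq: "(\<lambda>n. S (of_tensor (x n))) = (\<lambda>n. T (of_tensor (x n)))" for x :: "nat \<Rightarrow> _"
    by simp
  obtain x where x: "(\<lambda>n. of_tensor (x n)) \<longlonglongrightarrow> p" by (rule ptensor_cases)
  show "S p = T p"
    using LIMSEQ_unique[OF S.tendsto[OF x]] T.tendsto[OF x] unfolding eq by blast
qed

lemma ptensor_lift_exists:
  fixes \<phi> :: "'a::complex_normed_vector \<Rightarrow> 'b::complex_normed_vector \<Rightarrow> 'c::complex_banach"
  assumes "bounded_cbilinear \<phi>"
  shows "\<exists>T. bounded_clinear T \<and> (\<forall>a b. T (a \<otimes>\<^sub>\<pi> b) = \<phi> a b)"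
proof -
  interpret \<phi>: bounded_bilinear \<phi> using assms by (simp add: bounded_cbilinear_def)
  have \<phi>C: "\<phi> (c *\<^sub>C a) b = c *\<^sub>C \<phi> a b" "\<phi> a (c *\<^sub>C b) = c *\<^sub>C \<phi> a b" for c a b
    using assms by (auto simp: bounded_cbilinear_def)
  define s where "s xs = (\<Sum>(a, b)\<leftarrow>xs. \<phi> a b)" for xs
  have s_eq: "s xs = s ys" if "tensor_eq xs ys" for xs ys
    using that by induction (auto simp: s_def \<phi>.add_left \<phi>.add_right \<phi>.zero_left \<phi>C)
  define L where "L t = s (rep_tensor t)" for t
  have L_abs: "L (abs_tensor xs) = s xs" for xs
    unfolding L_def by (rule s_eq) (metis Quotient3_rep_abs Quotient3_tensor tensor_eq.refl)
  have L_add: "L (t + u) = L t + L u" for t u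
  proof -
    obtain xs ys where "t = abs_tensor xs" "u = abs_tensor ys" by (metis tensor_cases)
    then show ?thesis using L_abs by (simp add: plus_tensor.abs_eq) (simp add: s_def)
  qed
  have L_scaleC: "L (c *\<^sub>C t) = c *\<^sub>C L t" for c t
  proof -
    obtain xs where xs: "t = abs_tensor xs" by (rule tensor_cases)
    have "s (map (\<lambda>(a, b). (c *\<^sub>C a, b)) xs) = c *\<^sub>C s xs"
      unfolding s_def by (induction xs) (auto simp: \<phi>C scaleC_add_right scaleC_zero_right)
    then show ?thesis using xs by (simp add: scaleC_tensor.abs_eq L_abs)
  qed
  have L_diff: "L (t - u) = L t - L u" for t u
    using L_add[of "t - u" u] by simp
  obtain K where K: "K > 0" "\<And>a b. norm (\<phi> a b) \<le> norm a * norm b * K"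
    using \<phi>.pos_bounded by blast
  have s_le: "norm (s xs) \<le> K * rep_cost xs" for xs
  proof (induction xs)
    case (Cons p xs)
    obtain a b where p: "p = (a, b)" by (cases p)
    have "norm (s (p # xs)) \<le> norm (\<phi> a b) + norm (s xs)"
      by (simp add: s_def p norm_triangle_ineq)
    also have "\<dots> \<le> norm a * norm b * K + K * rep_cost xs"
      by (intro add_mono K Cons.IH)
    also have "\<dots> = K * rep_cost (p # xs)" by (simp add: p rep_cost_def algebra_simps)
    finally show ?case .
  qed (simp add: s_def rep_cost_def)
  have L_le: "norm (L t) \<le> K * proj_norm t" for t
  proof -
    have "norm (L t) / K \<le> proj_norm t"
      unfolding proj_norm_def
    proof (rule cINF_greatest[OF tensor_rep_nonempty])
      fix xs assume "xs \<in> {xs. abs_tensor xs = t}"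
      then show "norm (L t) / K \<le> rep_cost xs"
        using s_le[of xs] K(1) L_abs[of xs] by (auto simp: field_simps)
    qed
    then show ?thesis using K(1) by (simp add: field_simps)
  qed
  have "\<exists>l. \<forall>x. (\<lambda>n. of_tensor (x n)) \<longlonglongrightarrow> p \<longrightarrow> (\<lambda>n. L (x n)) \<longlonglongrightarrow> l" for p
  proof -
    obtain x where x: "(\<lambda>n. of_tensor (x n)) \<longlonglongrightarrow> p" by (rule ptensor_cases)
    have "Cauchy (\<lambda>n. L (x n))"
      unfolding Cauchy_def dist_norm
    proof (intro allI impI)
      fix e :: real assume "e > 0"
      then have "e / K > 0" using K(1) by simp
      with LIMSEQ_imp_Cauchy[OF x] obtain N
        where N: "\<And>m n. m \<ge> N \<Longrightarrow> n \<ge> N \<Longrightarrow> norm (of_tensor (x m) - of_tensor (x n)) < e / K"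
        unfolding Cauchy_def dist_norm by meson
      have "norm (L (x m) - L (x n)) < e" if "m \<ge> N" "n \<ge> N" for m n
        using N[OF that] L_le[of "x m - x n"] K(1)
        by (simp add: L_diff norm_of_tensor field_simps flip: of_tensor_diff)
      then show "\<exists>N. \<forall>m\<ge>N. \<forall>n\<ge>N. norm (L (x m) - L (x n)) < e" by blast
    qed
    then obtain l where l: "(\<lambda>n. L (x n)) \<longlonglongrightarrow> l"
      using Cauchy_convergent convergent_def by blast
    have "(\<lambda>n. L (y n)) \<longlonglongrightarrow> l" if y: "(\<lambda>n. of_tensor (y n)) \<longlonglongrightarrow> p" for y
    proof -
      have "(\<lambda>n. of_tensor (y n) - of_tensor (x n)) \<longlonglongrightarrow> 0"
        using tendsto_diff[OF y x] by simp
      then have "(\<lambda>n. L (y n) - L (x n)) \<longlonglongrightarrow> 0"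
        by (rule tendsto_0_le[where K = K])
          (use L_le in \<open>auto simp: norm_of_tensor mult.commute simp flip: of_tensor_diff L_diff\<close>)
      from tendsto_add[OF this l] show ?thesis by simp
    qed
    then show ?thesis by blast
  qed
  then obtain T where T: "\<And>p x. (\<lambda>n. of_tensor (x n)) \<longlonglongrightarrow> p \<Longrightarrow> (\<lambda>n. L (x n)) \<longlonglongrightarrow> T p"
    by metis
  have T_scaleC: "T (c *\<^sub>C p) = c *\<^sub>C T p" for c p
  proof -
    have l: "bounded_linear (\<lambda>x::'d::complex_normed_vector. c *\<^sub>C x)"
      by (rule bounded_linear_intro[of _ "cmod c"])
        (simp_all add: scaleC_add_right norm_scaleC scaleR_scaleC scaleC_scaleC mult.commute)
    obtain x where x: "(\<lambda>n. of_tensor (x n)) \<longlonglongrightarrow> p" by (rule ptensor_cases)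
    have "(\<lambda>n. of_tensor (c *\<^sub>C x n)) \<longlonglongrightarrow> c *\<^sub>C p"
      using bounded_linear.tendsto[OF l x] by (simp add: of_tensor_scaleC)
    from T[OF this] have "(\<lambda>n. c *\<^sub>C L (x n)) \<longlonglongrightarrow> T (c *\<^sub>C p)" by (simp add: L_scaleC)
    then show ?thesis
      using bounded_linear.tendsto[OF l T[OF x]] LIMSEQ_unique by blast
  qed
  have "bounded_linear T"
  proof (rule bounded_linear_intro)
    fix p q :: "('a, 'b) ptensor" and r :: real
    obtain x where x: "(\<lambda>n. of_tensor (x n)) \<longlonglongrightarrow> p" by (rule ptensor_cases)
    obtain y where y: "(\<lambda>n. of_tensor (y n)) \<longlonglongrightarrow> q" by (rule ptensor_cases)
    have "(\<lambda>n. of_tensor (x n + y n)) \<longlonglongrightarrow> p + q"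
      using tendsto_add[OF x y] by (simp add: of_tensor_add)
    from T[OF this] have "(\<lambda>n. L (x n) + L (y n)) \<longlonglongrightarrow> T (p + q)" by (simp add: L_add)
    then show "T (p + q) = T p + T q"
      using tendsto_add[OF T[OF x] T[OF y]] LIMSEQ_unique by blast
    show "T (r *\<^sub>R p) = r *\<^sub>R T p" by (simp add: scaleR_scaleC T_scaleC)
    have "norm (L (x n)) \<le> norm (of_tensor (x n)) * K" for n
      using L_le[of "x n"] by (simp add: norm_of_tensor mult.commute)
    then show "norm (T p) \<le> norm p * K"
      by (intro LIMSEQ_le[OF tendsto_norm[OF T[OF x]] tendsto_mult_right[OF tendsto_norm[OF x]]]) auto
  qed
  moreover have "T (a \<otimes>\<^sub>\<pi> b) = \<phi> a b" for a b
  proof -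
    have "(\<lambda>n::nat. L (elem_tensor a b)) \<longlonglongrightarrow> T (a \<otimes>\<^sub>\<pi> b)"
      by (rule T) (simp add: elem_ptensor_def)
    then have "T (a \<otimes>\<^sub>\<pi> b) = L (elem_tensor a b)" by (simp add: LIMSEQ_const_iff)
    then show ?thesis using L_abs[of "[(a, b)]"] by (simp add: elem_tensor.abs_eq s_def)
  qed
  ultimately show ?thesis using T_scaleC by (auto simp: bounded_clinear_def)
qed

lemma ptensor_lift:
  assumes "bounded_cbilinear \<phi>"
  shows "bounded_clinear (ptensor_lift \<phi>)" "ptensor_lift \<phi> (a \<otimes>\<^sub>\<pi> b) = \<phi> a b"
proof -
  obtain T where T: "bounded_clinear T" "\<And>a b. T (a \<otimes>\<^sub>\<pi> b) = \<phi> a b"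
    using ptensor_lift_exists[OF assms] by blast
  have "ptensor_lift \<phi> = T"
    unfolding ptensor_lift_def
  proof (rule the_equality)
    fix S assume S: "bounded_clinear S \<and> (\<forall>a b. S (a \<otimes>\<^sub>\<pi> b) = \<phi> a b)"
    show "S = T" by (rule ptensor_lift_unique) (simp_all add: S T)
  qed (simp add: T)
  then show "bounded_clinear (ptensor_lift \<phi>)" "ptensor_lift \<phi> (a \<otimes>\<^sub>\<pi> b) = \<phi> a b"
    by (simp_all add: T)
qed


section \<open>Bounded approximate diagonals\<close>

definition lact :: "'b::complex_banach_algebra \<Rightarrow> ('b, 'b) ptensor \<Rightarrow> ('b, 'b) ptensor"
  where "lact a = ptensor_lift (\<lambda>b c. (a * b) \<otimes>\<^sub>\<pi> c)"

definition ract :: "('b::complex_banach_algebra, 'b) ptensor \<Rightarrow> 'b \<Rightarrow> ('b, 'b) ptensor"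
  where "ract u a = ptensor_lift (\<lambda>b c. b \<otimes>\<^sub>\<pi> (c * a)) u"

definition ptensor_mult :: "('b::complex_banach_algebra, 'b) ptensor \<Rightarrow> 'b"
  where "ptensor_mult = ptensor_lift (*)"

lemma bounded_cbilinear_mult:
  "bounded_cbilinear ((*) :: 'b::complex_banach_algebra \<Rightarrow> 'b \<Rightarrow> 'b)"
  by (simp add: bounded_cbilinear_def bounded_bilinear_mult mult_scaleC_left mult_scaleC_right)

lemma bounded_cbilinear_lact:
  "bounded_cbilinear (\<lambda>b c. ((a :: 'b::complex_banach_algebra) * b) \<otimes>\<^sub>\<pi> (c :: 'b))"
proof -
  note t = bounded_cbilinear_elem_ptensor[where ?'a = 'b and ?'b = 'b, unfolded bounded_cbilinear_def]
  have "bounded_bilinear (\<lambda>b c. (a * b) \<otimes>\<^sub>\<pi> (c :: 'b))"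
    by (rule bounded_bilinear.comp[OF _ bounded_linear_mult_right bounded_linear_ident]) (use t in blast)
  with t show ?thesis by (simp add: bounded_cbilinear_def mult_scaleC_right)
qed

lemma bounded_cbilinear_ract:
  "bounded_cbilinear (\<lambda>b c. (b :: 'b::complex_banach_algebra) \<otimes>\<^sub>\<pi> (c * (a :: 'b)))"
proof -
  note t = bounded_cbilinear_elem_ptensor[where ?'a = 'b and ?'b = 'b, unfolded bounded_cbilinear_def]
  have "bounded_bilinear (\<lambda>b c. (b :: 'b) \<otimes>\<^sub>\<pi> (c * a))"
    by (rule bounded_bilinear.comp[OF _ bounded_linear_ident bounded_linear_mult_left]) (use t in blast)
  with t show ?thesis by (simp add: bounded_cbilinear_def mult_scaleC_left)
qed

lemma lact_elem: "lact a (b \<otimes>\<^sub>\<pi> c) = (a * b) \<otimes>\<^sub>\<pi> c"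
  by (simp add: lact_def ptensor_lift(2)[OF bounded_cbilinear_lact])

lemma ract_elem: "ract (b \<otimes>\<^sub>\<pi> c) a = b \<otimes>\<^sub>\<pi> (c * a)"
  by (simp add: ract_def ptensor_lift(2)[OF bounded_cbilinear_ract])

lemma ptensor_mult_elem: "ptensor_mult (a \<otimes>\<^sub>\<pi> b) = a * b"
  by (simp add: ptensor_mult_def ptensor_lift(2)[OF bounded_cbilinear_mult])

lemma bounded_clinear_lact: "bounded_clinear (lact a)"
  by (simp add: lact_def ptensor_lift(1)[OF bounded_cbilinear_lact])

lemma bounded_clinear_ract: "bounded_clinear (\<lambda>u. ract u a)"
  by (simp add: ract_def ptensor_lift(1)[OF bounded_cbilinear_ract])

lemma bounded_clinear_ptensor_mult: "bounded_clinear ptensor_mult"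
  by (simp add: ptensor_mult_def ptensor_lift(1)[OF bounded_cbilinear_mult])

definition directed_set :: "'i set \<Rightarrow> ('i \<Rightarrow> 'i \<Rightarrow> bool) \<Rightarrow> bool"
  where "directed_set I le \<longleftrightarrow> I \<noteq> {} \<and> (\<forall>i\<in>I. le i i) \<and>
    (\<forall>i\<in>I. \<forall>j\<in>I. \<forall>k\<in>I. le i j \<longrightarrow> le j k \<longrightarrow> le i k) \<and>
    (\<forall>i\<in>I. \<forall>j\<in>I. \<exists>k\<in>I. le i k \<and> le j k)"

definition net_filter :: "'i set \<Rightarrow> ('i \<Rightarrow> 'i \<Rightarrow> bool) \<Rightarrow> 'i filter"
  where "net_filter I le = (INF i\<in>I. principal {j \<in> I. le i j})"

lemma eventually_net_filter:
  assumes "directed_set I le"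
  shows "eventually P (net_filter I le) \<longleftrightarrow> (\<exists>i\<in>I. \<forall>j\<in>I. le i j \<longrightarrow> P j)"
proof -
  have "eventually P (net_filter I le) \<longleftrightarrow> (\<exists>i\<in>I. eventually P (principal {j \<in> I. le i j}))"
    unfolding net_filter_def
  proof (rule eventually_INF_base)
    show "I \<noteq> {}" using assms by (simp add: directed_set_def)
    fix i j assume ij: "i \<in> I" "j \<in> I"
    then obtain k where k: "k \<in> I" "le i k" "le j k"
      using assms unfolding directed_set_def by blast
    have "{l \<in> I. le k l} \<subseteq> {l \<in> I. le i l} \<inter> {l \<in> I. le j l}"
      using assms ij k unfolding directed_set_def by blast
    with k show "\<exists>k\<in>I. principal {l \<in> I. le k l} \<le> inf (principal {l \<in> I. le i l}) (principal {l \<in> I. le j l})"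
      by (auto intro!: bexI[of _ k])
  qed
  then show ?thesis by (auto simp: eventually_principal)
qed

definition bounded_approx_diagonal ::
    "('b::complex_banach_algebra \<Rightarrow> 'b) \<Rightarrow> 'i set \<Rightarrow> ('i \<Rightarrow> 'i \<Rightarrow> bool) \<Rightarrow> ('i \<Rightarrow> ('b, 'b) ptensor) \<Rightarrow> bool"
  where "bounded_approx_diagonal \<theta> I le u \<longleftrightarrow> directed_set I le \<and> bounded (u ` I) \<and>
    (\<forall>a. ((\<lambda>i. lact (\<theta> a) (u i) - ract (u i) (\<theta> a)) \<longlongrightarrow> 0) (net_filter I le) \<and>
         ((\<lambda>i. ptensor_mult (u i) * \<theta> a) \<longlongrightarrow> \<theta> a) (net_filter I le))"

text \<open>
  HOL cannot quantify over the type of the index set. The type chosen here, pairs of a set of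
  elements and a natural number, is no restriction: every net can be replaced by one
  indexed by it, as the next lemma shows.
\<close>

definition has_bounded_approx_diagonal :: "('b::complex_banach_algebra \<Rightarrow> 'b) \<Rightarrow> bool"
  where "has_bounded_approx_diagonal \<theta> \<longleftrightarrow>
    (\<exists>(I :: ('b set \<times> nat) set) le u. bounded_approx_diagonal \<theta> I le u)"

lemma has_bounded_approx_diagonalI:
  fixes \<theta> :: "'b::complex_banach_algebra \<Rightarrow> 'b" and I :: "'i set"
  assumes "bounded_approx_diagonal \<theta> I le u"
  shows "has_bounded_approx_diagonal \<theta>"
proof -
  define J :: "('b set \<times> nat) set" where "J = {(F, n). finite F}"
  define le' :: "'b set \<times> nat \<Rightarrow> 'b set \<times> nat \<Rightarrow> bool"
    where "le' p q \<longleftrightarrow> fst p \<subseteq> fst q \<and> snd p \<le> snd q" for p q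
  define good where "good a n i \<longleftrightarrow>
      norm (lact (\<theta> a) (u i) - ract (u i) (\<theta> a)) < inverse (real (Suc n)) \<and>
      norm (ptensor_mult (u i) * \<theta> a - \<theta> a) < inverse (real (Suc n))" for a n i
  have dir: "directed_set I le" and bd: "bounded (u ` I)"
    using assms by (auto simp: bounded_approx_diagonal_def)
  have ev: "eventually (good a n) (net_filter I le)" for a n
  proof -
    have l: "((\<lambda>i. lact (\<theta> a) (u i) - ract (u i) (\<theta> a)) \<longlongrightarrow> 0) (net_filter I le)"
      "((\<lambda>i. ptensor_mult (u i) * \<theta> a) \<longlongrightarrow> \<theta> a) (net_filter I le)"
      using assms by (auto simp: bounded_approx_diagonal_def)
    have "\<forall>\<^sub>F i in net_filter I le. dist (lact (\<theta> a) (u i) - ract (u i) (\<theta> a)) 0 < inverse (real (Suc n))"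
      by (rule tendstoD[OF l(1)]) simp
    moreover have "\<forall>\<^sub>F i in net_filter I le. dist (ptensor_mult (u i) * \<theta> a) (\<theta> a) < inverse (real (Suc n))"
      by (rule tendstoD[OF l(2)]) simp
    ultimately show ?thesis by eventually_elim (simp add: good_def dist_norm del: of_nat_Suc)
  qed
  have "\<exists>i\<in>I. \<forall>a\<in>fst p. good a (snd p) i" if "p \<in> J" for p
  proof -
    have "eventually (\<lambda>i. \<forall>a\<in>fst p. good a (snd p) i) (net_filter I le)"
      using that ev by (intro eventually_ball_finite) (auto simp: J_def)
    then obtain i where "i \<in> I" "\<forall>j\<in>I. le i j \<longrightarrow> (\<forall>a\<in>fst p. good a (snd p) j)"
      unfolding eventually_net_filter[OF dir] by blast
    moreover have "le i i" using dir \<open>i \<in> I\<close> unfolding directed_set_def by blast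
    ultimately show ?thesis by blast
  qed
  then obtain k where k: "\<And>p. p \<in> J \<Longrightarrow> k p \<in> I \<and> (\<forall>a\<in>fst p. good a (snd p) (k p))"
    by metis
  have dirJ: "directed_set J le'"
    unfolding directed_set_def
  proof (intro conjI ballI impI)
    show "J \<noteq> {}" by (auto simp: J_def)
    fix p q assume "p \<in> J" "q \<in> J"
    then show "\<exists>r\<in>J. le' p r \<and> le' q r"
      by (intro bexI[of _ "(fst p \<union> fst q, max (snd p) (snd q))"]) (auto simp: J_def le'_def)
  qed (auto simp: le'_def)
  have lim: "((\<lambda>p. f (k p)) \<longlongrightarrow> l) (net_filter J le')"
    if "\<And>n i. good a n i \<Longrightarrow> norm (f i - l) < inverse (real (Suc n))"
    for a and f :: "'i \<Rightarrow> 'z::real_normed_vector" and l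
  proof (rule tendstoI)
    fix e :: real assume "e > 0"
    then obtain n where n: "inverse (real (Suc n)) < e" using reals_Archimedean by blast
    have "dist (f (k p)) l < e" if "p \<in> J" "le' ({a}, n) p" for p
    proof -
      have "good a (snd p) (k p)" using k[OF that(1)] that(2) by (auto simp: le'_def)
      then have "norm (f (k p) - l) < inverse (real (Suc (snd p)))"
        using \<open>\<And>n i. good a n i \<Longrightarrow> norm (f i - l) < inverse (real (Suc n))\<close> by blast
      also have "\<dots> \<le> inverse (real (Suc n))"
        using that(2) by (simp add: le'_def)
      finally show ?thesis using n by (simp add: dist_norm)
    qed
    moreover have "({a}, n) \<in> J" by (simp add: J_def)
    ultimately show "eventually (\<lambda>p. dist (f (k p)) l < e) (net_filter J le')"
      unfolding eventually_net_filter[OF dirJ] by blast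
  qed
  have "bounded_approx_diagonal \<theta> J le' (\<lambda>p. u (k p))"
    unfolding bounded_approx_diagonal_def
  proof (intro conjI allI dirJ)
    show "bounded ((\<lambda>p. u (k p)) ` J)"
      by (rule bounded_subset[OF bd]) (use k in auto)
    fix a
    show "((\<lambda>p. lact (\<theta> a) (u (k p)) - ract (u (k p)) (\<theta> a)) \<longlongrightarrow> 0) (net_filter J le')"
      by (rule lim[of a "\<lambda>i. lact (\<theta> a) (u i) - ract (u i) (\<theta> a)"])
        (simp add: good_def)
    show "((\<lambda>p. ptensor_mult (u (k p)) * \<theta> a) \<longlongrightarrow> \<theta> a) (net_filter J le')"
      by (rule lim[of a "\<lambda>i. ptensor_mult (u i) * \<theta> a"]) (simp add: good_def)
  qed
  then show ?thesis unfolding has_bounded_approx_diagonal_def by blast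
qed

end

theory Submission
  imports Defs
begin

text \<open>
  Let \<open>u\<close> be an element of the approximate diagonal of \<open>A\<close>, regarded as a tensor of constant
  functions. It nearly commutes with the constants \<open>\<sigma> a\<close>. For a real continuous \<open>g\<close> the map
  \<open>Q (b \<otimes> c) = e\<^sup>-\<^sup>i\<^sup>g b \<otimes> e\<^sup>i\<^sup>g c\<close> is a contraction that commutes with both module actions and
  preserves \<open>\<pi>\<close>; replacing \<open>u\<close> by the average of \<open>Q\<^sup>k u\<close> over \<open>k < N\<close> makes it nearly commute
  with \<open>e\<^sup>i\<^sup>g \<sigma> a\<close> as well, up to an error of order \<open>1/N\<close>, without increasing its norm or spoiling
  what was achieved before. Hence finitely many functions \<open>e\<^sup>i\<^sup>g a\<close> can be treated one after the
  other. Their span is dense in \<open>C(X,A)\<close>: partitions of unity reduce this to functions \<open>h a\<close>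
  with \<open>h\<close> real and \<open>\<bar>h\<bar> \<le> 1\<close>, and \<open>h = (e\<^sup>i\<^sup>g + e\<^sup>-\<^sup>i\<^sup>g) / 2\<close> for \<open>g = arccos h\<close>. The uniform bound on
  the norms passes from the dense span to all of \<open>C(X,A)\<close>.
\<close>

section \<open>Bounded linear maps on projective tensor products\<close>

text \<open>Every representation of a finite tensor bounds its image by \<open>K\<close> times the
  cost; the infimum gives the projective norm, and density carries the bound to the completion. The
  explicit constant is the point: it lets contractions be recognised as such.\<close>

lemma norm_bounded_clinear_ptensor_le:
  fixes T :: "('a::complex_normed_vector, 'b::complex_normed_vector) ptensor \<Rightarrow> 'c::complex_normed_vector"
  assumes T: "bounded_clinear T" and K: "K \<ge> 0"
    and le: "\<And>a b. norm (T (a \<otimes>\<^sub>\<pi> b)) \<le> K * (norm a * norm b)"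
  shows "norm (T p) \<le> K * norm p"
proof -
  interpret T: bounded_linear T using T by (simp add: bounded_clinear_def)
  have sum_le: "norm (T (of_tensor (abs_tensor xs))) \<le> K * rep_cost xs" for xs
    unfolding of_tensor_abs_tensor
  proof (induction xs)
    case (Cons q xs)
    obtain a b where q: "q = (a, b)" by (cases q)
    show ?case
      using norm_triangle_ineq[of "T (a \<otimes>\<^sub>\<pi> b)" "T (\<Sum>(a, b)\<leftarrow>xs. a \<otimes>\<^sub>\<pi> b)"] le[of a b] Cons.IH
      by (simp add: q T.add rep_cost_def distrib_left)
  qed (simp add: T.zero rep_cost_def)
  have le': "norm (T (of_tensor t)) \<le> norm (of_tensor t) * K" for t
  \<comment> \<open>Passing to the infimum divides by \<open>K\<close>, so \<open>K = 0\<close> is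
    treated apart.\<close>
  proof (cases "K = 0")
    case True
    obtain xs where "t = abs_tensor xs" by (rule tensor_cases)
    then show ?thesis using sum_le[of xs] True by simp
  next
    case False
    then have "K > 0" using K by simp
    have "norm (T (of_tensor t)) / K \<le> proj_norm t"
      unfolding proj_norm_def
    proof (rule cINF_greatest[OF tensor_rep_nonempty])
      fix xs assume "xs \<in> {xs. abs_tensor xs = t}"
      then show "norm (T (of_tensor t)) / K \<le> rep_cost xs"
        using sum_le[of xs] \<open>K > 0\<close> by (auto simp: field_simps)
    qed
    then show ?thesis using \<open>K > 0\<close> by (simp add: field_simps norm_of_tensor)
  qed
  obtain x where x: "(\<lambda>n. of_tensor (x n)) \<longlonglongrightarrow> p" by (rule ptensor_cases)
  have "norm (T p) \<le> norm p * K"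
    by (intro LIMSEQ_le[OF tendsto_norm[OF T.tendsto[OF x]] tendsto_mult_right[OF tendsto_norm[OF x]]])
      (use le' in auto)
  then show ?thesis by (simp add: mult.commute)
qed

lemma bounded_clinear_bounded_linear: "bounded_clinear T \<Longrightarrow> bounded_linear T"
  by (simp add: bounded_clinear_def)

lemma bounded_clinear_ident: "bounded_clinear (\<lambda>x. x)"
  by (simp add: bounded_clinear_def)

lemma bounded_clinear_compose:
  "bounded_clinear S \<Longrightarrow> bounded_clinear T \<Longrightarrow> bounded_clinear (\<lambda>x. S (T x))"
  by (simp add: bounded_clinear_def bounded_linear_compose)

lemma bounded_clinear_add:
  "bounded_clinear S \<Longrightarrow> bounded_clinear T \<Longrightarrow> bounded_clinear (\<lambda>x. S x + T x)"
  by (simp add: bounded_clinear_def bounded_linear_add scaleC_add_right)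

lemma bounded_clinear_scaleC:
  assumes "bounded_clinear T"
  shows "bounded_clinear (\<lambda>x. c *\<^sub>C T x)"
proof -
  have "bounded_clinear (\<lambda>x::'b. c *\<^sub>C x)"
    unfolding bounded_clinear_def
    by (intro conjI allI bounded_linear_intro[of _ "cmod c"])
      (simp_all add: scaleC_add_right norm_scaleC scaleR_scaleC scaleC_scaleC mult.commute)
  from bounded_clinear_compose[OF this assms] show ?thesis .
qed

section \<open>Tensor products of linear maps\<close>

definition ptensor_map ::
    "('a::complex_normed_vector \<Rightarrow> 'c::complex_normed_vector) \<Rightarrow>
     ('b::complex_normed_vector \<Rightarrow> 'd::complex_normed_vector) \<Rightarrow> ('a, 'b) ptensor \<Rightarrow> ('c, 'd) ptensor"
  where "ptensor_map S T = ptensor_lift (\<lambda>a b. S a \<otimes>\<^sub>\<pi> T b)"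

lemma
  fixes S :: "'a::complex_normed_vector \<Rightarrow> 'c::complex_normed_vector"
    and T :: "'b::complex_normed_vector \<Rightarrow> 'd::complex_normed_vector"
  assumes "bounded_clinear S" "bounded_clinear T"
  shows bounded_clinear_ptensor_map: "bounded_clinear (ptensor_map S T)"
    and ptensor_map_elem: "ptensor_map S T (a \<otimes>\<^sub>\<pi> b) = S a \<otimes>\<^sub>\<pi> T b"
proof -
  note t = bounded_cbilinear_elem_ptensor[where ?'a = 'c and ?'b = 'd, unfolded bounded_cbilinear_def]
  have "bounded_bilinear (\<lambda>a b. S a \<otimes>\<^sub>\<pi> T b)"
    by (rule bounded_bilinear.comp) (use t assms in \<open>auto simp: bounded_clinear_def\<close>)
  with t assms have "bounded_cbilinear (\<lambda>a b. S a \<otimes>\<^sub>\<pi> T b)"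
    by (simp add: bounded_cbilinear_def bounded_clinear_def)
  from ptensor_lift[OF this]
  show "bounded_clinear (ptensor_map S T)" "ptensor_map S T (a \<otimes>\<^sub>\<pi> b) = S a \<otimes>\<^sub>\<pi> T b"
    by (simp_all add: ptensor_map_def)
qed

lemma norm_ptensor_map_le:
  assumes "bounded_clinear S" "bounded_clinear T"
    and "\<And>a. norm (S a) \<le> norm a" "\<And>b. norm (T b) \<le> norm b"
  shows "norm (ptensor_map S T p) \<le> norm p"
proof -
  have "norm (ptensor_map S T (a \<otimes>\<^sub>\<pi> b)) \<le> 1 * (norm a * norm b)" for a b
  proof -
    have "norm (S a \<otimes>\<^sub>\<pi> T b) \<le> norm (S a) * norm (T b)" by (rule norm_elem_ptensor)
    also have "\<dots> \<le> norm a * norm b" by (intro mult_mono assms) auto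
    finally show ?thesis by (simp add: ptensor_map_elem[OF assms(1,2)])
  qed
  from norm_bounded_clinear_ptensor_le[OF bounded_clinear_ptensor_map[OF assms(1,2)] _ this]
  show ?thesis by simp
qed

section \<open>The bimodule structure: norm estimates and commutators\<close>

lemma norm_lact_le: "norm (lact a u) \<le> norm a * norm u"
proof (rule norm_bounded_clinear_ptensor_le[OF bounded_clinear_lact])
  fix b c
  have "norm (lact a (b \<otimes>\<^sub>\<pi> c)) \<le> norm (a * b) * norm c"
    unfolding lact_elem by (rule norm_elem_ptensor)
  also have "\<dots> \<le> norm a * norm b * norm c"
    by (intro mult_right_mono norm_mult_ineq) auto
  finally show "norm (lact a (b \<otimes>\<^sub>\<pi> c)) \<le> norm a * (norm b * norm c)" by (simp add: mult.assoc)
qed simp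

lemma norm_ract_le: "norm (ract u a) \<le> norm a * norm u"
proof (rule norm_bounded_clinear_ptensor_le[OF bounded_clinear_ract])
  fix b c
  have "norm (ract (b \<otimes>\<^sub>\<pi> c) a) \<le> norm b * norm (c * a)"
    unfolding ract_elem by (rule norm_elem_ptensor)
  also have "\<dots> \<le> norm b * (norm c * norm a)"
    by (intro mult_left_mono norm_mult_ineq) auto
  finally show "norm (ract (b \<otimes>\<^sub>\<pi> c) a) \<le> norm a * (norm b * norm c)" by (simp add: ac_simps)
qed simp

lemma norm_ptensor_mult_le: "norm (ptensor_mult u) \<le> norm u"
  using norm_bounded_clinear_ptensor_le[OF bounded_clinear_ptensor_mult, of 1 u]
  by (simp add: ptensor_mult_elem norm_mult_ineq)

text \<open>The commutator of \<open>a\<close> and \<open>u\<close>; along an approximate diagonal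
  it tends to 0 at every \<open>\<theta> a\<close>.\<close>

definition comm_defect :: "'b::complex_banach_algebra \<Rightarrow> ('b, 'b) ptensor \<Rightarrow> ('b, 'b) ptensor"
  where "comm_defect a u = lact a u - ract u a"

text \<open>The actions are separate lifts for each algebra element, so linearity in
  \<open>a\<close> is not built in. Both sides are bounded and linear in \<open>u\<close>, hence
  comparing them on elementary tensors suffices.\<close>

lemma linear_comm_defect: "linear (\<lambda>a. comm_defect a u)"
proof (rule linearI)
  have elem: "(a + b) \<otimes>\<^sub>\<pi> c = a \<otimes>\<^sub>\<pi> c + b \<otimes>\<^sub>\<pi> c" "c \<otimes>\<^sub>\<pi> (a + b) = c \<otimes>\<^sub>\<pi> a + c \<otimes>\<^sub>\<pi> b"
    "(z *\<^sub>C a) \<otimes>\<^sub>\<pi> c = z *\<^sub>C (a \<otimes>\<^sub>\<pi> c)" "c \<otimes>\<^sub>\<pi> (z *\<^sub>C a) = z *\<^sub>C (c \<otimes>\<^sub>\<pi> a)" for a b c :: 'a and z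
    by (simp_all add: elem_ptensor_def elem_tensor_simps of_tensor_add of_tensor_scaleC)
  fix a b :: 'a and r :: real
  have "lact (a + b) = (\<lambda>u. lact a u + lact b u)"
    by (rule ptensor_lift_unique[OF bounded_clinear_lact
        bounded_clinear_add[OF bounded_clinear_lact bounded_clinear_lact]])
      (simp add: lact_elem elem distrib_right)
  moreover have "(\<lambda>u. ract u (a + b)) = (\<lambda>u. ract u a + ract u b)"
    by (rule ptensor_lift_unique[OF bounded_clinear_ract
        bounded_clinear_add[OF bounded_clinear_ract bounded_clinear_ract]])
      (simp add: ract_elem elem distrib_left)
  ultimately show "comm_defect (a + b) u = comm_defect a u + comm_defect b u"
    unfolding comm_defect_def by (metis add_diff_add)
  have "lact (r *\<^sub>R a) = (\<lambda>u. of_real r *\<^sub>C lact a u)"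
    by (rule ptensor_lift_unique[OF bounded_clinear_lact
        bounded_clinear_scaleC[OF bounded_clinear_lact]])
      (simp add: lact_elem elem scaleR_scaleC mult_scaleC_left)
  moreover have "(\<lambda>u. ract u (r *\<^sub>R a)) = (\<lambda>u. of_real r *\<^sub>C ract u a)"
    by (rule ptensor_lift_unique[OF bounded_clinear_ract
        bounded_clinear_scaleC[OF bounded_clinear_ract]])
      (simp add: ract_elem elem scaleR_scaleC mult_scaleC_right)
  ultimately show "comm_defect (r *\<^sub>R a) u = r *\<^sub>R comm_defect a u"
    unfolding comm_defect_def scaleR_scaleC scaleC_diff_right by metis
qed

lemma norm_comm_defect_le: "norm (comm_defect a u) \<le> 2 * norm u * norm a"
  using norm_triangle_ineq4[of "lact a u" "ract u a"] norm_lact_le[of a u] norm_ract_le[of u a]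
  by (simp add: comm_defect_def mult.commute)

section \<open>Approximate diagonals tested on finite sets\<close>

text \<open>Eventual properties of a net survive finite conjunctions. \<open>M\<close> is fixed
  before \<open>F\<close> and \<open>e\<close>, so tensors selected for different finite sets stay
  uniformly bounded.\<close>

lemma bounded_approx_diagonal_finite:
  fixes \<theta> :: "'b::complex_banach_algebra \<Rightarrow> 'b"
  assumes "bounded_approx_diagonal \<theta> I le u"
  obtains M where "\<And>F e. finite F \<Longrightarrow> e > 0 \<Longrightarrow> \<exists>v. norm v \<le> M \<and>
    (\<forall>a\<in>F. norm (comm_defect (\<theta> a) v) < e \<and> norm (ptensor_mult v * \<theta> a - \<theta> a) < e)"
proof -
  have dir: "directed_set I le" and bd: "bounded (u ` I)"
    and l: "\<And>a. ((\<lambda>i. lact (\<theta> a) (u i) - ract (u i) (\<theta> a)) \<longlongrightarrow> 0) (net_filter I le)"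
      "\<And>a. ((\<lambda>i. ptensor_mult (u i) * \<theta> a) \<longlongrightarrow> \<theta> a) (net_filter I le)"
    using assms by (auto simp: bounded_approx_diagonal_def)
  obtain M where M: "\<And>i. i \<in> I \<Longrightarrow> norm (u i) \<le> M" using bd by (auto simp: bounded_iff)
  show ?thesis
  proof (rule that)
    fix F :: "'b set" and e :: real assume F: "finite F" and e: "e > 0"
    have "\<forall>\<^sub>F i in net_filter I le. \<forall>a\<in>F. norm (comm_defect (\<theta> a) (u i)) < e \<and>
        norm (ptensor_mult (u i) * \<theta> a - \<theta> a) < e"
      using tendstoD[OF l(1) e] tendstoD[OF l(2) e]
      by (intro eventually_ball_finite F ballI eventually_conj)
        (simp_all add: dist_norm comm_defect_def)
    then obtain i where i: "i \<in> I" and *: "\<And>j. j \<in> I \<Longrightarrow> le i j \<Longrightarrow>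
        \<forall>a\<in>F. norm (comm_defect (\<theta> a) (u j)) < e \<and> norm (ptensor_mult (u j) * \<theta> a - \<theta> a) < e"
      unfolding eventually_net_filter[OF dir] by blast
    have "le i i" using dir i by (simp add: directed_set_def)
    then show "\<exists>v. norm v \<le> M \<and>
        (\<forall>a\<in>F. norm (comm_defect (\<theta> a) v) < e \<and> norm (ptensor_mult v * \<theta> a - \<theta> a) < e)"
      using M[OF i] *[OF i] by blast
  qed
qed

text \<open>Linearity gives the limit on the span; the eventual bound \<open>K\<close> makes the
  error of replacing \<open>a\<close> by a nearby element of the span uniform in the index.\<close>

lemma tendsto_zero_dense_span:
  fixes T :: "'i \<Rightarrow> 'a::real_normed_vector \<Rightarrow> 'b::real_normed_vector"
  assumes lin: "\<And>i. linear (T i)"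
    and bd: "eventually (\<lambda>i. \<forall>a. norm (T i a) \<le> K * norm a) F"
    and S: "\<And>a. a \<in> S \<Longrightarrow> ((\<lambda>i. T i a) \<longlongrightarrow> 0) F"
    and dense: "closure (span S) = UNIV"
  shows "((\<lambda>i. T i a) \<longlongrightarrow> 0) F"
proof (rule tendstoI)
  fix e :: real assume e: "e > 0"
  have span: "((\<lambda>i. T i b) \<longlongrightarrow> 0) F" if "b \<in> span S" for b
    using that
  proof (induction rule: span_induct_alt)
    case base
    show ?case by (simp add: linear_0[OF lin])
  next
    case (step c x y)
    have "((\<lambda>i. c *\<^sub>R T i x + T i y) \<longlongrightarrow> c *\<^sub>R 0 + 0) F"
      by (intro tendsto_intros S step)
    then show ?case by (simp add: linear_add[OF lin] linear_scale[OF lin])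
  qed
  \<comment> \<open>Chosen so that \<open>(\<bar>K\<bar> + 1) * d = e / 2\<close>; the factor is
    positive whatever the sign of \<open>K\<close>.\<close>
  define d where "d = e / (2 * (\<bar>K\<bar> + 1))"
  have d: "d > 0" using e by (simp add: d_def add_nonneg_pos)
  obtain b where b: "b \<in> span S" "norm (a - b) < d"
    using dense d by (metis UNIV_I closure_approachable dist_norm norm_minus_commute)
  have "\<forall>\<^sub>F i in F. dist (T i b) 0 < e / 2" using tendstoD[OF span[OF b(1)], of "e / 2"] e by simp
  with bd show "\<forall>\<^sub>F i in F. dist (T i a) 0 < e"
  proof eventually_elim
    case (elim i)
    have "norm (T i (a - b)) \<le> K * norm (a - b)" using elim(1) by blast
    also have "\<dots> \<le> (\<bar>K\<bar> + 1) * d" using b(2) by (intro mult_mono) auto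
    also have "\<dots> = e / 2" by (simp add: d_def field_simps)
    finally have "norm (T i a - T i b) \<le> e / 2" by (simp add: linear_diff[OF lin])
    then show ?case using elim(2) norm_triangle_ineq[of "T i a - T i b" "T i b"] by simp
  qed
qed

text \<open>A converse of \<open>bounded_approx_diagonal_finite\<close> that tests only finite
  subsets of \<open>S\<close>: the solutions form a net, and the common bound \<open>M\<close>
  extends convergence from \<open>S\<close> to the whole algebra.\<close>

lemma has_bounded_approx_diagonal_dense:
  fixes \<theta> :: "'b::complex_banach_algebra \<Rightarrow> 'b"
  assumes \<theta>: "bounded_linear \<theta>" and dense: "closure (span S) = UNIV"
    and ex: "\<And>F e. finite F \<Longrightarrow> F \<subseteq> S \<Longrightarrow> e > 0 \<Longrightarrow> \<exists>v. norm v \<le> M \<and>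
      (\<forall>a\<in>F. norm (comm_defect (\<theta> a) v) < e \<and> norm (ptensor_mult v * \<theta> a - \<theta> a) < e)"
  shows "has_bounded_approx_diagonal \<theta>"
proof -
  interpret \<theta>: bounded_linear \<theta> by (rule \<theta>)
  \<comment> \<open>A pair \<open>(F, n)\<close> stands for the test on \<open>F\<close> with
    tolerance \<open>1 / (n + 1)\<close>.\<close>
  define J :: "('b set \<times> nat) set" where "J = {(F, n). finite F \<and> F \<subseteq> S}"
  define le where "le p q \<longleftrightarrow> fst p \<subseteq> fst q \<and> snd p \<le> snd q" for p q :: "'b set \<times> nat"
  have dir: "directed_set J le"
    unfolding directed_set_def
  proof (intro conjI ballI impI)
    show "J \<noteq> {}" by (auto simp: J_def)
    fix p q assume "p \<in> J" "q \<in> J"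
    then show "\<exists>r\<in>J. le p r \<and> le q r"
      by (intro bexI[of _ "(fst p \<union> fst q, max (snd p) (snd q))"]) (auto simp: J_def le_def)
  qed (auto simp: le_def)
  have "\<exists>v. norm v \<le> M \<and> (\<forall>a\<in>fst p. norm (comm_defect (\<theta> a) v) < inverse (real (Suc (snd p))) \<and>
      norm (ptensor_mult v * \<theta> a - \<theta> a) < inverse (real (Suc (snd p))))" if "p \<in> J" for p
    using that by (intro ex) (auto simp: J_def)
  then obtain U where U: "\<And>p. p \<in> J \<Longrightarrow> norm (U p) \<le> M"
      "\<And>p a. p \<in> J \<Longrightarrow> a \<in> fst p \<Longrightarrow> norm (comm_defect (\<theta> a) (U p)) < inverse (real (Suc (snd p)))"
      "\<And>p a. p \<in> J \<Longrightarrow> a \<in> fst p \<Longrightarrow>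
        norm (ptensor_mult (U p) * \<theta> a - \<theta> a) < inverse (real (Suc (snd p)))"
    by metis
  \<comment> \<open>Beyond the index \<open>({a}, n)\<close> every set contains \<open>a\<close> and
    every tolerance is at most \<open>1 / (n + 1)\<close>.\<close>
  have null: "(f \<longlongrightarrow> 0) (net_filter J le)"
    if a: "a \<in> S" and f: "\<And>p. p \<in> J \<Longrightarrow> a \<in> fst p \<Longrightarrow> norm (f p) < inverse (real (Suc (snd p)))"
    for a and f :: "'b set \<times> nat \<Rightarrow> 'z::real_normed_vector"
  proof (rule tendstoI)
    fix e :: real assume "e > 0"
    then obtain n where n: "inverse (real (Suc n)) < e" using reals_Archimedean by blast
    have "dist (f p) 0 < e" if "p \<in> J" "le ({a}, n) p" for p
    proof -
      have "norm (f p) < inverse (real (Suc (snd p)))" using that by (intro f) (auto simp: le_def)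
      also have "\<dots> \<le> inverse (real (Suc n))" using that(2) by (simp add: le_def)
      finally show ?thesis using n by simp
    qed
    moreover have "({a}, n) \<in> J" using a by (simp add: J_def)
    ultimately show "\<forall>\<^sub>F p in net_filter J le. dist (f p) 0 < e"
      unfolding eventually_net_filter[OF dir] by blast
  qed
  \<comment> \<open>\<open>U\<close> is controlled only on \<open>J\<close>, so the norm bounds
    below are claimed only eventually.\<close>
  have evJ: "\<forall>\<^sub>F p in net_filter J le. p \<in> J"
  proof -
    have "J \<noteq> {}" using dir by (simp add: directed_set_def)
    then show ?thesis unfolding eventually_net_filter[OF dir] by blast
  qed
  obtain K where K: "\<And>a. norm (\<theta> a) \<le> norm a * K" "K \<ge> 0" using \<theta>.nonneg_bounded by blast
  have c: "((\<lambda>p. comm_defect (\<theta> a) (U p)) \<longlongrightarrow> 0) (net_filter J le)" for a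
  proof (rule tendsto_zero_dense_span[where T = "\<lambda>p a. comm_defect (\<theta> a) (U p)", OF _ _ _ dense])
    show "linear (\<lambda>a. comm_defect (\<theta> a) (U p))" for p
      using linear_compose[OF \<theta>.linear_axioms linear_comm_defect[of "U p"]] by (simp add: o_def)
    show "\<forall>\<^sub>F p in net_filter J le. \<forall>a. norm (comm_defect (\<theta> a) (U p)) \<le> (2 * M * K) * norm a"
      using evJ
    proof eventually_elim
      case (elim p)
      show ?case
      proof
        fix a
        have "norm (comm_defect (\<theta> a) (U p)) \<le> 2 * norm (U p) * norm (\<theta> a)"
          by (rule norm_comm_defect_le)
        also have "\<dots> \<le> 2 * M * (norm a * K)"
          using U(1)[OF elim] K order_trans[OF norm_ge_zero U(1)[OF elim]] by (intro mult_mono) auto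
        finally show "norm (comm_defect (\<theta> a) (U p)) \<le> (2 * M * K) * norm a" by (simp add: ac_simps)
      qed
    qed
  qed (rule null, use U in auto)
  have m: "((\<lambda>p. ptensor_mult (U p) * \<theta> a - \<theta> a) \<longlongrightarrow> 0) (net_filter J le)" for a
  proof (rule tendsto_zero_dense_span[where T = "\<lambda>p a. ptensor_mult (U p) * \<theta> a - \<theta> a", OF _ _ _ dense])
    show "linear (\<lambda>a. ptensor_mult (U p) * \<theta> a - \<theta> a)" for p
      by (rule linearI) (simp_all add: \<theta>.add \<theta>.scaleR algebra_simps)
    show "\<forall>\<^sub>F p in net_filter J le. \<forall>a. norm (ptensor_mult (U p) * \<theta> a - \<theta> a) \<le> ((M + 1) * K) * norm a"
      using evJ
    proof eventually_elim
      case (elim p)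
      show ?case
      proof
        fix a
        have "norm (ptensor_mult (U p) * \<theta> a - \<theta> a) \<le> norm (ptensor_mult (U p) * \<theta> a) + norm (\<theta> a)"
          by (rule norm_triangle_ineq4)
        also have "\<dots> \<le> norm (ptensor_mult (U p)) * norm (\<theta> a) + norm (\<theta> a)"
          by (intro add_mono norm_mult_ineq order_refl)
        also have "\<dots> = (norm (ptensor_mult (U p)) + 1) * norm (\<theta> a)" by (simp add: algebra_simps)
        also have "\<dots> \<le> (M + 1) * (norm a * K)"
          using U(1)[OF elim] K norm_ptensor_mult_le[of "U p"] order_trans[OF norm_ge_zero U(1)[OF elim]]
          by (intro mult_mono) auto
        finally show "norm (ptensor_mult (U p) * \<theta> a - \<theta> a) \<le> ((M + 1) * K) * norm a"
          by (simp add: ac_simps)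
      qed
    qed
  qed (rule null, use U in auto)
  have "bounded_approx_diagonal \<theta> J le U"
    unfolding bounded_approx_diagonal_def
  proof (intro conjI allI dir)
    show "bounded (U ` J)" unfolding bounded_iff using U(1) by blast
    show "((\<lambda>p. lact (\<theta> a) (U p) - ract (U p) (\<theta> a)) \<longlongrightarrow> 0) (net_filter J le)" for a
      using c[of a] by (simp add: comm_defect_def)
    show "((\<lambda>p. ptensor_mult (U p) * \<theta> a) \<longlongrightarrow> \<theta> a) (net_filter J le)" for a
      using m[of a] by (rule LIM_zero_cancel)
  qed
  then show ?thesis unfolding has_bounded_approx_diagonal_def by blast
qed

section \<open>Averages of the powers of a contraction\<close>

text \<open>The Cesaro mean of the ergodic theorem. For \<open>N = 0\<close> it is 0, since
  \<open>inverse 0 = 0\<close>.\<close>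

definition power_mean :: "('a::real_vector \<Rightarrow> 'a) \<Rightarrow> nat \<Rightarrow> 'a \<Rightarrow> 'a"
  where "power_mean Q N u = inverse (real N) *\<^sub>R (\<Sum>k<N. (Q ^^ k) u)"

text \<open>Having two maps covers both uses: \<open>R\<close> is again a phase conjugation when
  \<open>T\<close> commutes with it, and the identity when \<open>T\<close> is invariant under
  \<open>Q\<close>.\<close>

lemma power_mean_commute:
  assumes T: "linear T" and c: "\<And>u. T (Q u) = R (T u)"
  shows "T (power_mean Q N u) = power_mean R N (T u)"
proof -
  have "T ((Q ^^ k) u) = (R ^^ k) (T u)" for k by (induction k) (auto simp: c)
  then show ?thesis by (simp add: power_mean_def linear_scale[OF T] linear_sum[OF T])
qed

lemma norm_power_mean_le:
  fixes Q :: "'a::real_normed_vector \<Rightarrow> 'a"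
  assumes "\<And>u. norm (Q u) \<le> norm u"
  shows "norm (power_mean Q N u) \<le> norm u"
proof (cases "N = 0")
  case False
  have "norm ((Q ^^ k) u) \<le> norm u" for k
    by (induction k) (auto intro: order_trans[OF assms])
  then have "norm (\<Sum>k<N. (Q ^^ k) u) \<le> of_nat (card {..<N}) * norm u"
    by (intro sum_norm_bound)
  then show ?thesis using False by (simp add: power_mean_def field_simps)
qed (simp add: power_mean_def)

lemma linear_power_mean:
  assumes "linear Q"
  shows "linear (power_mean Q N)"
proof -
  have "linear (Q ^^ k)" for k
    by (induction k) (auto intro: linear_compose[OF _ assms, unfolded o_def] linear_id[unfolded id_def] simp: o_def id_def)
  then show ?thesis unfolding power_mean_def[abs_def]
    by (intro linear_compose_scale_right linear_compose_sum ballI) auto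
qed

text \<open>The sum telescopes to \<open>(Q ^^ N) u - u\<close>, of norm at most
  \<open>2 * norm u\<close>; this is the source of the gain \<open>1/N\<close>.\<close>

lemma norm_power_mean_diff_le:
  fixes Q :: "'a::real_normed_vector \<Rightarrow> 'a"
  assumes "\<And>u. norm (Q u) \<le> norm u"
  shows "norm (power_mean Q N (Q u) - power_mean Q N u) \<le> inverse (real N) * (2 * norm u)"
proof -
  have le: "norm ((Q ^^ k) u) \<le> norm u" for k
    by (induction k) (auto intro: order_trans[OF assms])
  have "power_mean Q N (Q u) - power_mean Q N u
      = inverse (real N) *\<^sub>R (\<Sum>k<N. (Q ^^ Suc k) u - (Q ^^ k) u)"
    by (simp add: power_mean_def sum_subtractf scaleR_diff_right funpow_swap1)
  also have "(\<Sum>k<N. (Q ^^ Suc k) u - (Q ^^ k) u) = (Q ^^ N) u - u"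
    using sum_lessThan_telescope[of "\<lambda>k. (Q ^^ k) u" N] by simp
  finally show ?thesis
    using norm_triangle_ineq4[of "(Q ^^ N) u" u] le[of N]
    by (auto intro!: mult_left_mono)
qed

section \<open>Unimodular multipliers\<close>

text \<open>Multiplication by \<open>e^(i g)\<close>. Parametrising by the real exponent makes
  composition additive in \<open>g\<close> and gives the inverse as
  \<open>phase (- g)\<close>.\<close>

definition phase :: "('x::topological_space \<Rightarrow>\<^sub>C real) \<Rightarrow> ('x \<Rightarrow>\<^sub>C 'a::complex_normed_vector) \<Rightarrow> ('x \<Rightarrow>\<^sub>C 'a)"
  where "phase g f = Bcontfun (\<lambda>x. cis (g x) *\<^sub>C f x)"

lemma continuous_on_scaleC:
  fixes f :: "'x::topological_space \<Rightarrow> 'a::complex_normed_vector"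
  assumes "continuous_on S c" "continuous_on S f"
  shows "continuous_on S (\<lambda>x. c x *\<^sub>C f x)"
proof -
  have "bounded_bilinear (\<lambda>c. scaleC c :: 'a \<Rightarrow> 'a)"
    by (rule bounded_bilinear.intro)
      (auto simp: scaleC_add_right scaleC_add_left scaleC_scaleC scaleR_scaleC norm_scaleC
        scaleR_conv_of_real mult.commute intro!: exI[of _ 1])
  from bounded_bilinear.continuous_on[OF this assms] show ?thesis .
qed

lemma apply_phase: "apply_bcontfun (phase g f) x = cis (g x) *\<^sub>C f x"
proof -
  have "(\<lambda>x. cis (g x) *\<^sub>C f x) \<in> bcontfun"
    by (rule bcontfun_normI[of _ "norm f"])
      (auto intro!: continuous_on_scaleC continuous_intros simp: norm_scaleC norm_bounded)
  then show ?thesis by (simp add: phase_def Bcontfun_inverse)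
qed

lemma norm_phase_le: "norm (phase g f) \<le> norm f"
  by (rule norm_bound) (simp add: apply_phase norm_scaleC norm_bounded)

lemma bounded_clinear_phase: "bounded_clinear (phase g)"
  unfolding bounded_clinear_def
proof (intro conjI allI bounded_linear_intro)
  show "norm (phase g f) \<le> norm f * 1" for f :: "'a \<Rightarrow>\<^sub>C 'b" by (simp add: norm_phase_le)
qed (auto intro!: bcontfun_eqI simp: apply_phase scaleC_bcontfun.rep_eq scaleC_add_right
    scaleC_scaleC scaleR_scaleC mult.commute)

lemma phase_phase: "phase g (phase h f) = phase (g + h) f"
  by (rule bcontfun_eqI) (simp add: apply_phase scaleC_scaleC cis_mult)

lemma phase_zero: "phase 0 f = f"
  by (rule bcontfun_eqI) (simp add: apply_phase scaleC_one)

lemma phase_mult_left: "phase g f * h = phase g (f * h)"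
  and phase_mult_right: "f * phase g h = phase g (f * h)"
  by (rule bcontfun_eqI, simp add: apply_phase times_bcontfun.rep_eq mult_scaleC_left mult_scaleC_right)+

text \<open>The map \<open>Q\<close> of the idea: conjugation of a tensor by the multiplier
  \<open>e^(i g)\<close>. It is built from multipliers because \<open>A\<close> may have no
  unit.\<close>

definition phase_conj ::
    "('x::topological_space \<Rightarrow>\<^sub>C real) \<Rightarrow> ('x \<Rightarrow>\<^sub>C 'a::complex_normed_vector, 'x \<Rightarrow>\<^sub>C 'a) ptensor \<Rightarrow>
      ('x \<Rightarrow>\<^sub>C 'a, 'x \<Rightarrow>\<^sub>C 'a) ptensor"
  where "phase_conj g = ptensor_map (phase (- g)) (phase g)"

lemma bounded_clinear_phase_conj: "bounded_clinear (phase_conj g)"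
  unfolding phase_conj_def by (intro bounded_clinear_ptensor_map bounded_clinear_phase)

lemma phase_conj_elem: "phase_conj g (a \<otimes>\<^sub>\<pi> b) = phase (- g) a \<otimes>\<^sub>\<pi> phase g b"
  unfolding phase_conj_def by (intro ptensor_map_elem bounded_clinear_phase)

lemma norm_phase_conj_le: "norm (phase_conj g u) \<le> norm u"
  unfolding phase_conj_def
  by (intro norm_ptensor_map_le bounded_clinear_phase norm_phase_le)

lemma linear_phase_conj: "linear (phase_conj g)"
  by (intro bounded_linear.linear bounded_clinear_bounded_linear bounded_clinear_phase_conj)

text \<open>On elementary tensors a scalar function moves freely through products, and elementary
  tensors determine bounded linear maps.\<close>

lemma phase_conj_lact: "lact c (phase_conj g u) = phase_conj g (lact c u)"
  for c :: "'x::topological_space \<Rightarrow>\<^sub>C 'a::complex_banach_algebra"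
proof -
  have "(\<lambda>u. lact c (phase_conj g u)) = (\<lambda>u. phase_conj g (lact c u))"
    by (rule ptensor_lift_unique[OF bounded_clinear_compose[OF bounded_clinear_lact bounded_clinear_phase_conj]
        bounded_clinear_compose[OF bounded_clinear_phase_conj bounded_clinear_lact]])
      (simp add: lact_elem phase_conj_elem phase_mult_right)
  then show ?thesis by (rule fun_cong)
qed

lemma phase_conj_ract: "ract (phase_conj g u) c = phase_conj g (ract u c)"
  for c :: "'x::topological_space \<Rightarrow>\<^sub>C 'a::complex_banach_algebra"
proof -
  have "(\<lambda>u. ract (phase_conj g u) c) = (\<lambda>u. phase_conj g (ract u c))"
    by (rule ptensor_lift_unique[OF bounded_clinear_compose[OF bounded_clinear_ract bounded_clinear_phase_conj]
        bounded_clinear_compose[OF bounded_clinear_phase_conj bounded_clinear_ract]])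
      (simp add: ract_elem phase_conj_elem phase_mult_left)
  then show ?thesis by (rule fun_cong)
qed

lemma phase_conj_comm_defect: "comm_defect c (phase_conj g u) = phase_conj g (comm_defect c u)"
  for c :: "'x::topological_space \<Rightarrow>\<^sub>C 'a::complex_banach_algebra"
  by (simp add: comm_defect_def phase_conj_lact phase_conj_ract linear_diff[OF linear_phase_conj])

text \<open>The factors \<open>e^(-i g)\<close> and \<open>e^(i g)\<close> cancel in the
  product.\<close>

lemma ptensor_mult_phase_conj: "ptensor_mult (phase_conj g u) = ptensor_mult u"
  for u :: "('x::topological_space \<Rightarrow>\<^sub>C 'a::complex_banach_algebra, 'x \<Rightarrow>\<^sub>C 'a) ptensor"
proof -
  have "(\<lambda>u::('x \<Rightarrow>\<^sub>C 'a, 'x \<Rightarrow>\<^sub>C 'a) ptensor. ptensor_mult (phase_conj g u)) = ptensor_mult"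
    by (rule ptensor_lift_unique[OF bounded_clinear_compose[OF bounded_clinear_ptensor_mult bounded_clinear_phase_conj]
        bounded_clinear_ptensor_mult])
      (simp add: ptensor_mult_elem phase_conj_elem phase_mult_left phase_mult_right
        phase_phase phase_zero)
  then show ?thesis by (rule fun_cong)
qed

text \<open>In the first tensor factor the two phases cancel, leaving \<open>e^(i g)\<close> on the
  second. By \<open>ract_phase\<close> the right action of \<open>phase g c\<close> is that of
  \<open>c\<close> followed by the same map, so the two can be compared.\<close>

lemma phase_conj_lact_phase:
  fixes c :: "'x::topological_space \<Rightarrow>\<^sub>C 'a::complex_banach_algebra"
  shows "phase_conj g (lact (phase g c) u) = ptensor_map (\<lambda>b. b) (phase g) (lact c u)"
proof -
  note pm = bounded_clinear_ident bounded_clinear_phase[of g]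
  have "(\<lambda>u. phase_conj g (lact (phase g c) u)) = (\<lambda>u. ptensor_map (\<lambda>b. b) (phase g) (lact c u))"
    by (rule ptensor_lift_unique[OF bounded_clinear_compose[OF bounded_clinear_phase_conj bounded_clinear_lact]
        bounded_clinear_compose[OF bounded_clinear_ptensor_map[OF pm] bounded_clinear_lact]])
      (simp add: lact_elem phase_conj_elem ptensor_map_elem[OF pm] phase_mult_left
        phase_phase phase_zero)
  then show ?thesis by (rule fun_cong)
qed

lemma ract_phase:
  fixes c :: "'x::topological_space \<Rightarrow>\<^sub>C 'a::complex_banach_algebra"
  shows "ract u (phase g c) = ptensor_map (\<lambda>b. b) (phase g) (ract u c)"
proof -
  note pm = bounded_clinear_ident bounded_clinear_phase[of g]
  have "(\<lambda>u. ract u (phase g c)) = (\<lambda>u. ptensor_map (\<lambda>b. b) (phase g) (ract u c))"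
    by (rule ptensor_lift_unique[OF bounded_clinear_ract
        bounded_clinear_compose[OF bounded_clinear_ptensor_map[OF pm] bounded_clinear_ract]])
      (simp add: ract_elem ptensor_map_elem[OF pm] phase_mult_right)
  then show ?thesis by (rule fun_cong)
qed

text \<open>Put \<open>v = lact (phase g c) u\<close>. Then \<open>ract u (phase g c)\<close>
  differs from \<open>Q v\<close> only by a contraction applied to the commutator of
  \<open>c\<close> and \<open>u\<close>. Averaging preserves the size of that term and makes
  \<open>Q v - v\<close> of order \<open>1/N\<close>.\<close>

lemma comm_defect_phase_power_mean_le:
  fixes c :: "'x::topological_space \<Rightarrow>\<^sub>C 'a::complex_banach_algebra"
  shows "norm (comm_defect (phase g c) (power_mean (phase_conj g) N u))
    \<le> norm (comm_defect c u) + inverse (real N) * (2 * (norm c * norm u))"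
proof -
  let ?Q = "phase_conj g :: ('x \<Rightarrow>\<^sub>C 'a, 'x \<Rightarrow>\<^sub>C 'a) ptensor \<Rightarrow> _"
  let ?E = "power_mean ?Q N" and ?R = "ptensor_map (\<lambda>b. b) (phase g) :: ('x \<Rightarrow>\<^sub>C 'a, 'x \<Rightarrow>\<^sub>C 'a) ptensor \<Rightarrow> _"
  define v where "v = lact (phase g c) u"
  note lin = bounded_linear.linear[OF bounded_clinear_bounded_linear]
  have E: "linear ?E" by (rule linear_power_mean[OF linear_phase_conj])
  have R: "linear ?R" by (intro lin bounded_clinear_ptensor_map bounded_clinear_ident bounded_clinear_phase)
  have Qv: "?Q v = ?R (lact c u)" unfolding v_def by (rule phase_conj_lact_phase)
  have "lact (phase g c) (?E u) = ?E v"
    unfolding v_def by (intro power_mean_commute phase_conj_lact lin bounded_clinear_lact)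
  moreover have "ract (?E u) (phase g c) = ?E (ract u (phase g c))"
    by (intro power_mean_commute[where T = "\<lambda>u. ract u (phase g c)"] phase_conj_ract lin bounded_clinear_ract)
  moreover have "ract u (phase g c) = ?Q v - ?R (comm_defect c u)"
    unfolding ract_phase Qv by (simp add: comm_defect_def linear_diff[OF R])
  ultimately have eq: "comm_defect (phase g c) (?E u) = ?E (?R (comm_defect c u)) - (?E (?Q v) - ?E v)"
    unfolding comm_defect_def[of "phase g c"] by (simp add: linear_diff[OF E])
  have "norm (?E (?R (comm_defect c u))) \<le> norm (?R (comm_defect c u))"
    by (intro norm_power_mean_le norm_phase_conj_le)
  also have "\<dots> \<le> norm (comm_defect c u)"
    by (intro norm_ptensor_map_le bounded_clinear_ident bounded_clinear_phase norm_phase_le order_refl)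
  finally have 1: "norm (?E (?R (comm_defect c u))) \<le> norm (comm_defect c u)" .
  have "norm (?E (?Q v) - ?E v) \<le> inverse (real N) * (2 * norm v)"
    by (intro norm_power_mean_diff_le norm_phase_conj_le)
  also have "norm v \<le> norm (phase g c) * norm u" unfolding v_def by (rule norm_lact_le)
  also have "norm (phase g c) * norm u \<le> norm c * norm u"
    by (intro mult_right_mono norm_phase_le) simp
  finally have "norm (?E (?Q v) - ?E v) \<le> inverse (real N) * (2 * (norm c * norm u))"
    by (simp add: mult_left_mono)
  with 1 show ?thesis
    unfolding eq using norm_triangle_ineq4[of "?E (?R (comm_defect c u))" "?E (?Q v) - ?E v"] by simp
qed

text \<open>Induction on \<open>G\<close>, averaging once for each \<open>g\<close>. Averaging
  commutes with forming commutators and is contractive, so it keeps all earlier estimates; the same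
  \<open>e\<close> serves throughout because the inequalities are strict.\<close>

lemma comm_defect_phase_small:
  fixes u :: "('x::topological_space \<Rightarrow>\<^sub>C 'a::complex_banach_algebra, 'x \<Rightarrow>\<^sub>C 'a) ptensor"
  assumes "finite G" "finite C" "\<And>c. c \<in> C \<Longrightarrow> norm (comm_defect c u) < e"
  shows "\<exists>v. norm v \<le> norm u \<and> ptensor_mult v = ptensor_mult u \<and>
    (\<forall>c\<in>C. norm (comm_defect c v) < e \<and> (\<forall>g\<in>G. norm (comm_defect (phase g c) v) < e))"
  using assms(1)
proof (induction G)
  case empty
  then show ?case using assms(3) by auto
next
  case (insert g G)
  then obtain v where v: "norm v \<le> norm u" "ptensor_mult v = ptensor_mult u"
      "\<And>c. c \<in> C \<Longrightarrow> norm (comm_defect c v) < e"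
      "\<And>c h. c \<in> C \<Longrightarrow> h \<in> G \<Longrightarrow> norm (comm_defect (phase h c) v) < e"
    by blast
  let ?Q = "phase_conj g :: ('x \<Rightarrow>\<^sub>C 'a, 'x \<Rightarrow>\<^sub>C 'a) ptensor \<Rightarrow> _"
  \<comment> \<open>Each strict inequality leaves room for a term of order \<open>1/N\<close>, and
    finitely many \<open>c\<close> admit a common \<open>N\<close>.\<close>
  have "\<forall>\<^sub>F N in sequentially. N > 0 \<and>
      (\<forall>c\<in>C. norm (comm_defect c v) + inverse (real N) * (2 * (norm c * norm v)) < e)"
  proof (intro eventually_conj eventually_ball_finite assms(2) ballI eventually_gt_at_top)
    fix c assume c: "c \<in> C"
    have "(\<lambda>N. norm (comm_defect c v) + inverse (real N) * (2 * (norm c * norm v)))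
        \<longlonglongrightarrow> norm (comm_defect c v) + 0 * (2 * (norm c * norm v))"
      by (intro tendsto_intros lim_inverse_n)
    then show "\<forall>\<^sub>F N in sequentially. norm (comm_defect c v) + inverse (real N) * (2 * (norm c * norm v)) < e"
      by (rule order_tendstoD(2)) (simp add: v(3)[OF c])
  qed
  then obtain N where N: "N > 0"
      "\<And>c. c \<in> C \<Longrightarrow> norm (comm_defect c v) + inverse (real N) * (2 * (norm c * norm v)) < e"
    by (auto simp: eventually_sequentially)
  let ?w = "power_mean ?Q N v"
  note lin = bounded_linear.linear[OF bounded_clinear_bounded_linear]
  \<comment> \<open>Here \<open>c\<close> is any algebra element, so the estimate also covers
    \<open>phase h c\<close> for the functions \<open>h\<close> already treated.\<close>
  have le: "norm (comm_defect c ?w) \<le> norm (comm_defect c v)" for c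
  proof -
    have "linear (comm_defect c)"
      unfolding comm_defect_def[abs_def]
      by (intro linear_compose_sub lin bounded_clinear_lact bounded_clinear_ract)
    then have "comm_defect c ?w = power_mean ?Q N (comm_defect c v)"
      by (rule power_mean_commute) (rule phase_conj_comm_defect)
    then show ?thesis using norm_power_mean_le[of ?Q, OF norm_phase_conj_le] by simp
  qed
  have "norm (comm_defect c ?w) < e" "\<And>h. h \<in> G \<Longrightarrow> norm (comm_defect (phase h c) ?w) < e" if "c \<in> C" for c
    using le le_less_trans v(3,4) that by blast+
  moreover have "norm (comm_defect (phase g c) ?w) < e" if "c \<in> C" for c
    using comm_defect_phase_power_mean_le[of g c N v] N(2)[OF that] by simp
  moreover have "norm ?w \<le> norm u"
    using norm_power_mean_le[of ?Q N v, OF norm_phase_conj_le] v(1) by simp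
  moreover have "ptensor_mult ?w = ptensor_mult u"
  proof -
    \<comment> \<open>The product map carries \<open>Q\<close> to the identity, whose mean is the
      identity because \<open>N > 0\<close>.\<close>
    have "ptensor_mult ?w = power_mean (\<lambda>x. x) N (ptensor_mult v)"
      by (intro power_mean_commute lin bounded_clinear_ptensor_mult ptensor_mult_phase_conj)
    moreover have "((\<lambda>x. x) ^^ k) y = y" for k and y :: "'x \<Rightarrow>\<^sub>C 'a"
      by (induction k) auto
    ultimately show ?thesis using N(1) v(2)
      by (simp add: power_mean_def sum_constant_scaleR)
  qed
  ultimately show ?case
    by (intro exI[of _ ?w]) auto
qed

section \<open>Constant functions\<close>

lemma bounded_clinear_const_bcontfun:
  "bounded_clinear (const_bcontfun :: 'a::complex_normed_vector \<Rightarrow> ('x::topological_space \<Rightarrow>\<^sub>C 'a))"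
  unfolding bounded_clinear_def
proof (intro conjI allI bounded_linear_intro)
  show "norm (const_bcontfun a :: 'x \<Rightarrow>\<^sub>C 'a) \<le> norm a * 1" for a :: 'a
    by (rule norm_bound) simp
qed (auto intro!: bcontfun_eqI simp: scaleC_bcontfun.rep_eq)

lemma norm_const_bcontfun_le: "norm (const_bcontfun a) \<le> norm a"
  by (rule norm_bound) simp

lemma const_bcontfun_mult: "const_bcontfun a * const_bcontfun b = const_bcontfun (a * b)"
  by (rule bcontfun_eqI) (simp add: times_bcontfun.rep_eq)

definition const_ptensor ::
    "('a::complex_normed_vector, 'a) ptensor \<Rightarrow> ('x::topological_space \<Rightarrow>\<^sub>C 'a, 'x \<Rightarrow>\<^sub>C 'a) ptensor"
  where "const_ptensor = ptensor_map const_bcontfun const_bcontfun"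

lemma bounded_clinear_const_ptensor: "bounded_clinear const_ptensor"
  unfolding const_ptensor_def by (intro bounded_clinear_ptensor_map bounded_clinear_const_bcontfun)

lemma const_ptensor_elem: "const_ptensor (a \<otimes>\<^sub>\<pi> b) = const_bcontfun a \<otimes>\<^sub>\<pi> const_bcontfun b"
  unfolding const_ptensor_def by (intro ptensor_map_elem bounded_clinear_const_bcontfun)

lemma norm_const_ptensor_le: "norm (const_ptensor u) \<le> norm u"
  unfolding const_ptensor_def
  by (intro norm_ptensor_map_le bounded_clinear_const_bcontfun norm_const_bcontfun_le)

text \<open>Embedding constants is multiplicative, so the induced map on tensors intertwines the
  module actions.\<close>

lemma comm_defect_const_ptensor:
  "comm_defect (const_bcontfun a) (const_ptensor u :: ('x::topological_space \<Rightarrow>\<^sub>C 'a::complex_banach_algebra, _) ptensor)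
    = const_ptensor (comm_defect a u)"
proof -
  let ?J = "const_ptensor :: _ \<Rightarrow> ('x \<Rightarrow>\<^sub>C 'a, 'x \<Rightarrow>\<^sub>C 'a) ptensor"
  have "(\<lambda>u. lact (const_bcontfun a) (?J u)) = (\<lambda>u. ?J (lact a u))"
    by (rule ptensor_lift_unique[OF bounded_clinear_compose[OF bounded_clinear_lact bounded_clinear_const_ptensor]
        bounded_clinear_compose[OF bounded_clinear_const_ptensor bounded_clinear_lact]])
      (simp add: lact_elem const_ptensor_elem const_bcontfun_mult)
  moreover have "(\<lambda>u. ract (?J u) (const_bcontfun a)) = (\<lambda>u. ?J (ract u a))"
    by (rule ptensor_lift_unique[OF bounded_clinear_compose[OF bounded_clinear_ract bounded_clinear_const_ptensor]
        bounded_clinear_compose[OF bounded_clinear_const_ptensor bounded_clinear_ract]])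
      (simp add: ract_elem const_ptensor_elem const_bcontfun_mult)
  moreover have "linear ?J"
    by (intro bounded_linear.linear bounded_clinear_bounded_linear bounded_clinear_const_ptensor)
  ultimately show ?thesis unfolding comm_defect_def by (metis linear_diff)
qed

lemma ptensor_mult_const_ptensor:
  "ptensor_mult (const_ptensor u :: ('x::topological_space \<Rightarrow>\<^sub>C 'a::complex_banach_algebra, _) ptensor)
    = const_bcontfun (ptensor_mult u)"
proof -
  let ?J = "const_ptensor :: _ \<Rightarrow> ('x \<Rightarrow>\<^sub>C 'a, 'x \<Rightarrow>\<^sub>C 'a) ptensor"
  have "(\<lambda>u. ptensor_mult (?J u)) = (\<lambda>u. const_bcontfun (ptensor_mult u))"
    by (rule ptensor_lift_unique[OF bounded_clinear_compose[OF bounded_clinear_ptensor_mult bounded_clinear_const_ptensor]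
        bounded_clinear_compose[OF bounded_clinear_const_bcontfun bounded_clinear_ptensor_mult]])
      (simp add: ptensor_mult_elem const_ptensor_elem const_bcontfun_mult)
  then show ?thesis by (rule fun_cong)
qed

section \<open>Density of the span of the modulated constants\<close>

text \<open>With \<open>g = arccos h\<close>, the average of \<open>e^(i g)\<close> and
  \<open>e^(-i g)\<close> is \<open>cos g = h\<close>. Since arccos takes values in
  \<open>[0, pi]\<close>, \<open>g\<close> is a bounded continuous function.\<close>

lemma scaleR_mem_span_phase:
  fixes h :: "'x::topological_space \<Rightarrow> real" and a :: "'a::complex_normed_vector"
  assumes h: "continuous_on UNIV h" "\<And>x. \<bar>h x\<bar> \<le> 1"
    and f: "\<And>x. apply_bcontfun f x = h x *\<^sub>R a"
  shows "f \<in> span {phase g (const_bcontfun a) |g a. True}"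
proof -
  have "(\<lambda>x. arccos (h x)) \<in> bcontfun"
  proof (rule bcontfun_normI)
    show "continuous_on UNIV (\<lambda>x. arccos (h x))"
      using h by (intro continuous_on_arccos) (auto simp: abs_le_iff minus_le_iff)
    show "norm (arccos (h x)) \<le> pi" for x
      using arccos_bounded[of "h x"] h(2)[of x] by (auto simp: abs_le_iff minus_le_iff)
  qed
  then obtain g where g: "\<And>x. apply_bcontfun g x = arccos (h x)"
    by (metis Bcontfun_inverse)
  have "f = (1/2) *\<^sub>R (phase g (const_bcontfun a) + phase (- g) (const_bcontfun a))"
  proof (rule bcontfun_eqI)
    fix x
    have "cis (g x) + cis (- g x) = complex_of_real (2 * h x)"
      using h(2)[of x] by (simp add: g complex_eq_iff cos_arccos_abs)
    then have "cis (g x) *\<^sub>C a + cis (- g x) *\<^sub>C a = (2 * h x) *\<^sub>R a"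
      by (simp only: scaleR_scaleC flip: scaleC_add_left)
    then show "apply_bcontfun f x
        = apply_bcontfun ((1/2) *\<^sub>R (phase g (const_bcontfun a) + phase (- g) (const_bcontfun a))) x"
      by (simp add: f apply_phase)
  qed
  moreover have "phase g (const_bcontfun a) \<in> span {phase g (const_bcontfun a) |g a. True}" for g :: "'x \<Rightarrow>\<^sub>C real"
    by (rule span_base) blast
  ultimately show ?thesis by (simp only: span_add span_scale)
qed

text \<open>The partition of unity is pulled back from the compact metric space \<open>f(X)\<close>, so that
  no separation property of \<open>X\<close> is involved.\<close>

lemma closure_span_phase:
  assumes X: "compact (UNIV :: 'x::topological_space set)"
  shows "closure (span {phase g (const_bcontfun a) |g a. True}) = (UNIV :: ('x \<Rightarrow>\<^sub>C 'a::complex_normed_vector) set)"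
proof (rule UNIV_eq_I[symmetric])
  fix f :: "'x \<Rightarrow>\<^sub>C 'a"
  show "f \<in> closure (span {phase g (const_bcontfun a) |g a. True})"
    unfolding closure_approachable
  proof (intro allI impI)
    fix e :: real assume e: "e > 0"
    have "compact (range f)" by (intro compact_continuous_image X) simp
    then obtain P where P: "finite P" "range f \<subseteq> (\<Union>p\<in>P. ball p (e / 2))"
      using e compactE_image[of "range f" "range f" "\<lambda>p. ball p (e / 2)"]
      by (metis UN_I centre_in_ball half_gt_zero open_ball subsetI)
    \<comment> \<open>Tent functions of \<open>f x\<close>, vanishing unless \<open>f x\<close> lies
      within \<open>e / 2\<close> of \<open>p\<close>. The balls cover the range of
      \<open>f\<close>, so their sum \<open>s\<close> is positive and can be divided out.\<close>
    define t where "t p x = max 0 (e / 2 - dist p (f x))" for p x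
    define s where "s x = (\<Sum>p\<in>P. t p x)" for x
    have t0: "t p x \<ge> 0" for p x by (simp add: t_def)
    have s: "s x > 0" for x
    proof -
      obtain p where p: "p \<in> P" "dist p (f x) < e / 2" using P(2) by fastforce
      then have "0 < t p x" by (simp add: t_def)
      also have "t p x \<le> s x" unfolding s_def using p t0 P(1) by (intro member_le_sum) auto
      finally show ?thesis .
    qed
    have ct: "continuous_on UNIV (t p)" for p
      unfolding t_def[abs_def] by (intro continuous_intros) auto
    define h where "h p x = t p x / s x" for p x
    have ch: "continuous_on UNIV (h p)" for p
      unfolding h_def[abs_def] s_def[abs_def]
      by (intro continuous_intros ct) (use s in \<open>auto simp: s_def less_imp_neq[symmetric]\<close>)
    have h0: "h p x \<ge> 0" for p x using s[of x] t0[of p x] by (simp add: h_def)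
    have hs: "(\<Sum>p\<in>P. h p x) = 1" for x
      using s[of x] by (simp add: h_def s_def flip: sum_divide_distrib)
    \<comment> \<open>This bound is what allows \<open>h p\<close> to be written as a
      cosine.\<close>
    have h1: "\<bar>h p x\<bar> \<le> 1" if "p \<in> P" for p x
      using member_le_sum[of p P "\<lambda>p. h p x"] hs[of x] h0 P(1) that by simp
    define k where "k p = Bcontfun (\<lambda>x. h p x *\<^sub>R p)" for p
    have k: "apply_bcontfun (k p) x = h p x *\<^sub>R p" for p x
      unfolding k_def
      by (subst Bcontfun_inverse) (auto intro!: bcontfun_of_compact X continuous_intros ch)
    have "(\<Sum>p\<in>P. k p) \<in> span {phase g (const_bcontfun a) |g a. True}"
      by (intro span_sum scaleR_mem_span_phase[OF ch h1 k])
    moreover have "dist (\<Sum>p\<in>P. k p) f < e"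
    proof -
      have "norm (f - (\<Sum>p\<in>P. k p)) \<le> e / 2"
      proof (rule norm_bound)
        fix x
        have "apply_bcontfun (\<Sum>p\<in>P. k p) x = (\<Sum>p\<in>P. h p x *\<^sub>R p)"
          using P(1) by (induction P rule: finite_induct) (auto simp: k)
        then have "(f - (\<Sum>p\<in>P. k p)) x = (\<Sum>p\<in>P. h p x *\<^sub>R (f x - p))"
          by (simp add: scaleR_diff_right sum_subtractf hs flip: scaleR_sum_left)
        also have "norm \<dots> \<le> (\<Sum>p\<in>P. h p x * (e / 2))"
        proof (intro sum_norm_le)
          fix p
          \<comment> \<open>Only centres \<open>p\<close> close to \<open>f x\<close> carry weight,
            so the weighted average of the \<open>p\<close> is close to \<open>f x\<close>.\<close>
          have "h p x = 0 \<or> norm (f x - p) \<le> e / 2"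
            by (auto simp: h_def t_def dist_norm norm_minus_commute max_def)
          then show "norm (h p x *\<^sub>R (f x - p)) \<le> h p x * (e / 2)"
            using h0[of p x] mult_left_mono[of "norm (f x - p)" "e / 2" "h p x"] by auto
        qed
        also have "\<dots> = e / 2" by (simp only: hs mult_1 flip: sum_distrib_right)
        finally show "norm ((f - (\<Sum>p\<in>P. k p)) x) \<le> e / 2" .
      qed
      then show ?thesis using e by (simp add: dist_norm norm_minus_commute)
    qed
    ultimately show "\<exists>y\<in>span {phase g (const_bcontfun a) |g a. True}. dist y f < e" by blast
  qed
qed

section \<open>Assembly of the approximate diagonal of C(X,A)\<close>

theorem theorem2p1:
  fixes \<sigma> :: "'a::complex_banach_algebra \<Rightarrow> 'a"
  assumes "compact (UNIV :: 'x::t2_space set)"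
    and "algebra_hom \<sigma>" and "continuous_on UNIV \<sigma>"
    and "has_bounded_approx_diagonal \<sigma>"
  shows "has_bounded_approx_diagonal (comp_bcontfun \<sigma> :: ('x \<Rightarrow>\<^sub>C 'a) \<Rightarrow> ('x \<Rightarrow>\<^sub>C 'a))"
proof -
  let ?\<theta> = "comp_bcontfun \<sigma> :: ('x \<Rightarrow>\<^sub>C 'a) \<Rightarrow> ('x \<Rightarrow>\<^sub>C 'a)"
  obtain I :: "('a set \<times> nat) set" and le u where "bounded_approx_diagonal \<sigma> I le u"
    using assms(4) unfolding has_bounded_approx_diagonal_def by blast
  then obtain M where M: "\<And>F e. finite F \<Longrightarrow> e > 0 \<Longrightarrow> \<exists>v. norm v \<le> M \<and>
      (\<forall>a\<in>F. norm (comm_defect (\<sigma> a) v) < e \<and> norm (ptensor_mult v * \<sigma> a - \<sigma> a) < e)"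
    by (rule bounded_approx_diagonal_finite) blast
  \<comment> \<open>\<sigma> is complex linear, so pointwise application passes through the scalar
    phases and maps generators to generators.\<close>
  have \<theta>: "?\<theta> (phase g (const_bcontfun a)) = phase g (const_bcontfun (\<sigma> a))" for g a
    by (rule bcontfun_eqI)
      (use assms(2) in \<open>simp add: apply_comp_bcontfun[OF assms(1,3)] apply_phase algebra_hom_def\<close>)
  show ?thesis
  proof (rule has_bounded_approx_diagonal_dense[OF _ closure_span_phase[OF assms(1)]])
    show "bounded_linear ?\<theta>"
      by (intro algebra_hom_bounded_linear algebra_hom_comp_bcontfun assms)
    fix F :: "('x \<Rightarrow>\<^sub>C 'a) set" and e :: real
    assume F: "finite F" "F \<subseteq> {phase g (const_bcontfun a) |g a. True}" and e: "e > 0"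
    have "F \<subseteq> (\<lambda>(g, a). phase g (const_bcontfun a)) ` UNIV" using F(2) by fastforce
    \<comment> \<open>\<open>P\<close> picks finitely many pairs \<open>(g, a)\<close> representing
      \<open>F\<close>; its projections supply the phases and the constants to be handled.\<close>
    then obtain P where P: "finite P" "F = (\<lambda>(g, a). phase g (const_bcontfun a)) ` P"
      using finite_subset_image[OF F(1)] by blast
    obtain v where v: "norm v \<le> M" "\<And>a. a \<in> snd ` P \<Longrightarrow> norm (comm_defect (\<sigma> a) v) < e"
        "\<And>a. a \<in> snd ` P \<Longrightarrow> norm (ptensor_mult v * \<sigma> a - \<sigma> a) < e"
      using M[of "snd ` P" e] P(1) e by blast
    have J: "norm (comm_defect c (const_ptensor v)) < e" if c: "c \<in> (\<lambda>a. const_bcontfun (\<sigma> a)) ` snd ` P"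
      for c :: "'x \<Rightarrow>\<^sub>C 'a"
    proof -
      obtain a where a: "a \<in> snd ` P" "c = const_bcontfun (\<sigma> a)" using c by blast
      show ?thesis
        unfolding a(2) comm_defect_const_ptensor by (rule le_less_trans[OF norm_const_ptensor_le v(2)[OF a(1)]])
    qed
    let ?v = "const_ptensor v :: ('x \<Rightarrow>\<^sub>C 'a, 'x \<Rightarrow>\<^sub>C 'a) ptensor"
    and ?C = "(\<lambda>a. const_bcontfun (\<sigma> a) :: 'x \<Rightarrow>\<^sub>C 'a) ` snd ` P"
    \<comment> \<open>All combinations of a phase and a constant from \<open>P\<close> are treated,
      which includes the pairs in \<open>P\<close> themselves.\<close>
    have "\<exists>w. norm w \<le> norm ?v \<and> ptensor_mult w = ptensor_mult ?v \<and>
        (\<forall>c\<in>?C. norm (comm_defect c w) < e \<and> (\<forall>g\<in>fst ` P. norm (comm_defect (phase g c) w) < e))"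
      by (rule comm_defect_phase_small[OF finite_imageI[OF P(1)] finite_imageI[OF finite_imageI[OF P(1)]] J])
    then obtain w where w: "norm w \<le> norm ?v" "ptensor_mult w = ptensor_mult ?v"
        and w': "\<forall>c\<in>?C. norm (comm_defect c w) < e \<and> (\<forall>g\<in>fst ` P. norm (comm_defect (phase g c) w) < e)"
      by (elim exE conjE)
    have comm: "norm (comm_defect (phase g (const_bcontfun (\<sigma> a))) w) < e" if "(g, a) \<in> P" for g a
      using w' that by force
    have "norm (ptensor_mult w * phase g (const_bcontfun (\<sigma> a)) - phase g (const_bcontfun (\<sigma> a))) < e"
      if a: "a \<in> snd ` P" for g a
    proof -
      \<comment> \<open>Averaging left the product equal to the constant function with value
        \<open>ptensor_mult v\<close>, so this error is a phase times a constant already known to be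
        small.\<close>
      have "ptensor_mult w * phase g (const_bcontfun (\<sigma> a)) - phase g (const_bcontfun (\<sigma> a))
          = phase g (const_bcontfun (ptensor_mult v * \<sigma> a - \<sigma> a))"
        by (rule bcontfun_eqI)
          (simp add: w(2) ptensor_mult_const_ptensor apply_phase times_bcontfun.rep_eq mult_scaleC_right
            scaleC_diff_right)
      also have "norm \<dots> \<le> norm (ptensor_mult v * \<sigma> a - \<sigma> a)"
        by (rule order_trans[OF norm_phase_le norm_const_bcontfun_le])
      finally show ?thesis using v(3)[OF a] by simp
    qed
    \<comment> \<open>The bound for \<open>A\<close> is inherited unchanged, since both the
      embedding and the averaging are contractive.\<close>
    moreover have "norm w \<le> M" using w(1) norm_const_ptensor_le v(1) by (meson order_trans)
    ultimately show "\<exists>v. norm v \<le> M \<and>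
        (\<forall>a\<in>F. norm (comm_defect (?\<theta> a) v) < e \<and> norm (ptensor_mult v * ?\<theta> a - ?\<theta> a) < e)"
      using comm unfolding P(2) by (intro exI[of _ w]) (force simp: \<theta>)
  qed
qed

end
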